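(* Let $1<p<\infty$ and $1/p+1/q=1$. For every function $f$ in $\Lambda^p(\mathbb{D})$ and every $\theta\in\mathbb{R}$, $$\left(\int_0^\infty\left(\frac{\mathcal{E}(r,\theta)}{\ell(r)}\right)^p d\ell(r)\right)^{1/p}\ \leqslant\ \frac{2q}{\pi^{1/p}}\,\|f'/\lambda_{\mathbb{D}}\|_p .$$ Consequently, $$\int_0^1\frac{\mathcal{E}(r,\theta)^p}{(1-r^2)\left(\log\frac{1+r}{1-r}\right)^p}\,dr\ <\ \infty .$$
   Context: $\mathbb{D}=\{|z|<1\}$, $\lambda_{\mathbb{D}}(z)=2/(1-|z|^2)$. $\Lambda^p(\mathbb{D})$ is the set of analytic functions $f:\mathbb{D}\to\mathbb{C}$ for which $$\|f'/\lambda_{\mathbb{D}}\|_p=\left(\int\!\!\int_{\mathbb{D}}\left(\frac{|f'(z)|}{\lambda_{\mathbb{D}}(z)}\right)^p\lambda_{\mathbb{D}}(z)^2\,dx\,dy\right)^{1/p}$$ is finite. $\mathcal{E}(r,\theta)=\int_0^r|f'(te^{i\theta})|\,dt$ and $\ell(r)=\log\frac{1+r}{1-r}$. The integral with respect to $d\ell(r)$ over $\ell\in(0,\infty)$ means the integral over $r\in(0,1)$ with $d\ell(r)=\ell'(r)\,dr=\frac{2}{1-r^2}\,dr$. *)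

theory Defs
  imports "HOL-Analysis.Analysis"
begin

definition hyp_density :: "complex \<Rightarrow> real" where
  "hyp_density z = 2 / (1 - (cmod z)\<^sup>2)"

definition Lambda_integrand :: "real \<Rightarrow> (complex \<Rightarrow> complex) \<Rightarrow> complex \<Rightarrow> real" where
  "Lambda_integrand p f z =
     (cmod (deriv f z) / hyp_density z) powr p * (hyp_density z)\<^sup>2"

text \<open>The integrands in this theory are nonnegative and, for holomorphic \<open>f\<close>, continuous on the
  domain of integration, so a finite integral is the same as (Lebesgue) integrability.
  Area measure \<open>dx dy\<close> is \<open>lborel\<close> on the type \<open>complex\<close>. Functions are total in HOL, but only
  the values of \<open>f\<close> on the open unit disc matter.\<close>

definition Lambda_space :: "real \<Rightarrow> (complex \<Rightarrow> complex) set" where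
  "Lambda_space p =
     {f. f holomorphic_on ball 0 1 \<and> set_integrable lborel (ball 0 1) (Lambda_integrand p f)}"

definition Lambda_norm :: "real \<Rightarrow> (complex \<Rightarrow> complex) \<Rightarrow> real" where
  "Lambda_norm p f = (LINT z:ball 0 1|lborel. Lambda_integrand p f z) powr (1 / p)"

definition radial_length :: "(complex \<Rightarrow> complex) \<Rightarrow> real \<Rightarrow> real \<Rightarrow> real" where
  "radial_length f r \<theta> = (LINT t:{0..r}|lborel. cmod (deriv f (of_real t * cis \<theta>)))"

definition hyp_length :: "real \<Rightarrow> real" where
  "hyp_length r = ln ((1 + r) / (1 - r))"

end

theory Submission
  imports Defs "HOL-Complex_Analysis.Complex_Analysis"
begin

unbundle no fps_syntax

text \<open>In the coordinate \<open>w = log ((1 + z) / (1 - z))\<close> the disc becomes the strip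
  \<open>\<bar>Im w\<bar> < \<pi> / 2\<close> with density \<open>1 / cos (Im w)\<close>, and a radius becomes a real half-line
  parametrised by hyperbolic length. If \<open>F\<close> is the derivative in this coordinate, the area mean
  value inequality for \<open>\<bar>F\<bar> powr p\<close> over unit discs centred at real points, integrated along the
  real line, gives \<open>\<integral>\<bar>F\<bar> powr p \<le> (2 / \<pi>) \<integral>\<integral>\<bar>F\<bar> powr p\<close>, the right-hand side over \<open>\<bar>Im w\<bar> < 1\<close>.
  There \<open>2 \<le> 2 powr p * cos (Im w) powr (p - 2)\<close>, so the \<open>p\<close>-th power integral along a radius is
  at most \<open>2 powr p / \<pi>\<close> times that over the disc. Hardy's inequality, with constant \<open>q\<close>, then
  passes from \<open>\<bar>F\<bar>\<close> to the averages of its primitive.\<close>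

section \<open>Change of variables under injective holomorphic maps\<close>

text \<open>The Jacobian formula used below is phrased with \<open>det\<close> and
  \<open>matrix\<close> on \<open>real^2\<close>, so plane areas are computed there and transported
  back to \<open>complex\<close>.\<close>

definition complex_of_vec :: "real^2 \<Rightarrow> complex" where
  "complex_of_vec x = Complex (x $ 1) (x $ 2)"

definition vec_of_complex :: "complex \<Rightarrow> real^2" where
  "vec_of_complex z = vector [Re z, Im z]"

lemma vec_of_complex_nth [simp]:
  "vec_of_complex z $ 1 = Re z" "vec_of_complex z $ 2 = Im z"
  by (simp_all add: vec_of_complex_def)

lemma complex_of_vec_sel [simp]:
  "Re (complex_of_vec x) = x $ 1" "Im (complex_of_vec x) = x $ 2"
  by (simp_all add: complex_of_vec_def)

lemma complex_of_vec_inverse [simp]: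
  "complex_of_vec (vec_of_complex z) = z" "vec_of_complex (complex_of_vec x) = x"
  by (simp_all add: complex_eq_iff vec_eq_iff forall_2)

lemma bounded_linear_complex_of_vec: "bounded_linear complex_of_vec"
  by (intro linear_conv_bounded_linear[THEN iffD1] linearI) (simp_all add: complex_eq_iff)

lemma bounded_linear_vec_of_complex: "bounded_linear vec_of_complex"
  by (intro linear_conv_bounded_linear[THEN iffD1] linearI) (simp_all add: vec_eq_iff forall_2)

lemma continuous_on_complex_of_vec: "continuous_on A complex_of_vec"
  by (rule linear_continuous_on[OF bounded_linear_complex_of_vec])

text \<open>Lebesgue measure is determined by its values on boxes, and the preimage of a box is a
  box with the same side lengths.\<close>

lemma distr_complex_of_vec: "distr lborel borel complex_of_vec = lborel"
proof (rule lborel_eqI[symmetric])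
  fix l u :: complex
  assume le: "\<And>b. b \<in> Basis \<Longrightarrow> l \<bullet> b \<le> u \<bullet> b"
  have "complex_of_vec -` box l u = box (vec_of_complex l) (vec_of_complex u)"
    by (auto simp: box_def Basis_complex_def Basis_vec_def inner_axis UNIV_2)
  moreover have "complex_of_vec \<in> borel_measurable borel"
    by (rule borel_measurable_continuous_onI[OF continuous_on_complex_of_vec])
  moreover have "prod f (Basis :: (real^2) set) = f (axis 1 1) * f (axis 2 1)"
    and "(\<forall>b\<in>(Basis :: (real^2) set). P b) \<longleftrightarrow> P (axis 1 1) \<and> P (axis 2 1)"
    for f :: "real^2 \<Rightarrow> real" and P
  proof -
    have *: "(Basis :: (real^2) set) = {axis 1 1, axis 2 1}" and **: "axis 1 1 \<noteq> (axis 2 1 :: real^2)"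
      by (auto simp: Basis_vec_def UNIV_2 axis_eq_axis)
    show "prod f (Basis :: (real^2) set) = f (axis 1 1) * f (axis 2 1)"
      by (subst *) (simp add: **)
    show "(\<forall>b\<in>(Basis :: (real^2) set). P b) \<longleftrightarrow> P (axis 1 1) \<and> P (axis 2 1)"
      by (subst *) simp
  qed
  ultimately show "emeasure (distr lborel borel complex_of_vec) (box l u) = (\<Prod>b\<in>Basis. (u - l) \<bullet> b)"
    using le[of 1] le[of \<i>]
    by (simp add: emeasure_distr emeasure_lborel_box_eq Basis_complex_def inner_axis)
qed simp

text \<open>The two notions differ only by completing the measure, which is harmless once the
  cut-off integrand is Borel. This lets substitution theorems for the gauge integral be used with
  \<open>lborel\<close>.\<close>

lemma absolutely_integrable_on_iff_set_integrable:
  fixes f :: "'a::euclidean_space \<Rightarrow> real"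
  assumes "S \<in> sets borel" "continuous_on S f"
  shows "f absolutely_integrable_on S \<longleftrightarrow> set_integrable lborel S f"
proof -
  have "(\<lambda>x. indicator S x *\<^sub>R f x) \<in> borel_measurable borel"
    by (rule borel_measurable_continuous_on_indicator) (use assms in auto)
  then show ?thesis
    unfolding set_integrable_def by (intro integrable_completion) simp
qed

lemma set_nn_integral_eq_set_integral:
  fixes f :: "'a \<Rightarrow> real"
  assumes "set_integrable M A f" "\<And>x. x \<in> A \<Longrightarrow> 0 \<le> f x"
  shows "(\<integral>\<^sup>+x\<in>A. ennreal (f x) \<partial>M) = ennreal (LINT x:A|M. f x)"
proof -
  have "(\<integral>\<^sup>+x. ennreal (indicator A x *\<^sub>R f x) \<partial>M) = ennreal (LINT x:A|M. f x)"
    unfolding set_lebesgue_integral_def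
    by (rule nn_integral_eq_integral)
      (use assms in \<open>auto simp: set_integrable_def indicator_def\<close>)
  then show ?thesis
    by (simp add: nn_integral_set_ennreal mult.commute)
qed

lemma set_integrable_complex_of_vec:
  fixes f :: "complex \<Rightarrow> real"
  assumes "S \<in> sets borel" "continuous_on S f"
  shows "set_integrable lborel (complex_of_vec -` S) (f \<circ> complex_of_vec) \<longleftrightarrow> set_integrable lborel S f"
    and "(LINT x:(complex_of_vec -` S)|lborel. (f \<circ> complex_of_vec) x) = (LINT z:S|lborel. f z)"
proof -
  have *: "(\<lambda>x. indicator S x *\<^sub>R f x) \<in> borel_measurable borel"
    by (rule borel_measurable_continuous_on_indicator) (use assms in auto)
  have m: "complex_of_vec \<in> measurable lborel borel"
    using borel_measurable_continuous_onI[OF continuous_on_complex_of_vec] by simp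
  have i: "indicator (complex_of_vec -` S) x = indicat_real S (complex_of_vec x)" for x
    by (simp add: indicator_def)
  show "set_integrable lborel (complex_of_vec -` S) (f \<circ> complex_of_vec) \<longleftrightarrow> set_integrable lborel S f"
    using integrable_distr_eq[OF m *] by (simp add: distr_complex_of_vec set_integrable_def i)
  show "(LINT x:(complex_of_vec -` S)|lborel. (f \<circ> complex_of_vec) x) = (LINT z:S|lborel. f z)"
    using integral_distr[OF m *] by (simp add: distr_complex_of_vec set_lebesgue_integral_def i)
qed

text \<open>By the Cauchy-Riemann equations, the real Jacobian determinant of \<open>g\<close> is
  the squared modulus of its complex derivative.\<close>

lemma holomorphic_change_of_variables:
  fixes g :: "complex \<Rightarrow> complex" and h :: "complex \<Rightarrow> real"
  assumes S: "open S" and g: "g holomorphic_on S" "inj_on g S"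
    and h: "continuous_on (g ` S) h" "set_integrable lborel (g ` S) h"
  shows "set_integrable lborel S (\<lambda>z. (cmod (deriv g z))\<^sup>2 * h (g z))"
    and "(LINT z:S|lborel. (cmod (deriv g z))\<^sup>2 * h (g z)) = (LINT z:g ` S|lborel. h z)"
proof -
  define T where "T = complex_of_vec -` S"
  define k where "k = vec_of_complex \<circ> g \<circ> complex_of_vec"
  define k' where "k' x = vec_of_complex \<circ> (*) (deriv g (complex_of_vec x)) \<circ> complex_of_vec" for x
  let ?H = "\<lambda>z. (cmod (deriv g z))\<^sup>2 * h (g z)"
  have T: "open T"
    unfolding T_def using S continuous_on_complex_of_vec by (rule open_vimage)
  \<comment> \<open>An injective holomorphic map is open, so the image is Borel.\<close>
  have gS: "open (g ` S)"
    using open_mapping_thm3 g S by blast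
  have k: "k ` T = complex_of_vec -` (g ` S)"
    unfolding k_def T_def
  proof (safe; simp)
    fix x z assume "complex_of_vec x = g z" "z \<in> S"
    then show "x \<in> (\<lambda>x. vec_of_complex (g (complex_of_vec x))) ` complex_of_vec -` S"
      by (intro image_eqI[of _ _ "vec_of_complex z"]) (auto, metis complex_of_vec_inverse(2))
  qed
  have kT: "open (k ` T)"
    unfolding k using gS continuous_on_complex_of_vec by (rule open_vimage)
  have der: "(k has_derivative k' x) (at x within T)" if "x \<in> T" for x
  proof -
    have "(complex_of_vec has_derivative complex_of_vec) (at x within T)"
      by (rule bounded_linear_imp_has_derivative[OF bounded_linear_complex_of_vec])
    moreover have "(g has_derivative (*) (deriv g (complex_of_vec x)))
        (at (complex_of_vec x) within complex_of_vec ` T)"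
      using holomorphic_derivI[OF g(1) S] that unfolding T_def has_field_derivative_def by auto
    moreover have "(vec_of_complex has_derivative vec_of_complex) (at y within A)" for y A
      by (rule bounded_linear_imp_has_derivative[OF bounded_linear_vec_of_complex])
    ultimately show ?thesis
      unfolding k_def k'_def comp_assoc by (blast intro: diff_chain_within)
  qed
  \<comment> \<open>Multiplication by \<open>a + b * \<i>\<close> has the matrix with rows (a, -b)
    and (b, a), whose determinant is a^2 + b^2.\<close>
  have det: "\<bar>det (matrix (k' x))\<bar> = (cmod (deriv g (complex_of_vec x)))\<^sup>2" for x
    by (simp add: det_2 matrix_def k'_def axis_def cmod_def power2_eq_square)
  have inj: "inj_on k T"
    using g(2) unfolding inj_on_def k_def T_def
    by (auto, metis complex_of_vec_inverse(1) complex_of_vec_inverse(2))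
  have cH: "continuous_on S ?H"
    by (intro continuous_intros continuous_on_compose2[OF h(1)] holomorphic_on_imp_continuous_on
        holomorphic_deriv g S) auto
  \<comment> \<open>The substitution theorem is about vector-valued integrands, so the real
    integrand is viewed in \<open>real^1\<close>.\<close>
  let ?h = "\<lambda>x. vec (h (complex_of_vec x)) :: real^1"
  have *: "(\<lambda>x. \<bar>det (matrix (k' x))\<bar> *\<^sub>R ?h (k x)) absolutely_integrable_on T \<and>
      integral T (\<lambda>x. \<bar>det (matrix (k' x))\<bar> *\<^sub>R ?h (k x)) = vec b \<longleftrightarrow>
      ?h absolutely_integrable_on (k ` T) \<and> integral (k ` T) ?h = vec b" for b
    by (rule has_absolute_integral_change_of_variables[OF _ der inj]) (use T in auto)
  have **: "(\<lambda>x. \<bar>det (matrix (k' x))\<bar> *\<^sub>R ?h (k x)) = (\<lambda>x. vec ((?H \<circ> complex_of_vec) x))"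
    by (simp only: det) (simp add: fun_eq_iff vec_eq_iff k_def)
  have main: "(?H \<circ> complex_of_vec) absolutely_integrable_on T \<and> integral T (?H \<circ> complex_of_vec) = b \<longleftrightarrow>
      (h \<circ> complex_of_vec) absolutely_integrable_on (k ` T) \<and> integral (k ` T) (h \<circ> complex_of_vec) = b" for b
    using *[of b] unfolding ** 
    by (simp add: absolutely_integrable_on_1_iff integral_on_1_eq o_def)
  have c1: "continuous_on (k ` T) (h \<circ> complex_of_vec)"
    by (intro continuous_on_compose continuous_on_complex_of_vec continuous_on_subset[OF h(1)]) (auto simp: k)
  have c2: "continuous_on T (?H \<circ> complex_of_vec)"
    by (intro continuous_on_compose continuous_on_complex_of_vec continuous_on_subset[OF cH]) (auto simp: T_def)
  have i1: "set_integrable lborel (k ` T) (h \<circ> complex_of_vec)"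
    using set_integrable_complex_of_vec(1)[OF _ h(1)] gS h(2) by (simp add: k)
  have "(h \<circ> complex_of_vec) absolutely_integrable_on (k ` T)"
    using absolutely_integrable_on_iff_set_integrable[OF _ c1] kT i1 by simp
  with main have H: "(?H \<circ> complex_of_vec) absolutely_integrable_on T"
     "integral T (?H \<circ> complex_of_vec) = integral (k ` T) (h \<circ> complex_of_vec)"
    by blast+
  have i2: "set_integrable lborel T (?H \<circ> complex_of_vec)"
    using absolutely_integrable_on_iff_set_integrable[OF _ c2] T H(1) by simp
  show "set_integrable lborel S ?H"
    using set_integrable_complex_of_vec(1)[OF _ cH] i2 S by (simp add: T_def)
  have "(LINT z:S|lborel. ?H z) = (LINT x:T|lborel. (?H \<circ> complex_of_vec) x)"
    using set_integrable_complex_of_vec(2)[OF _ cH] S by (simp add: T_def)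
  also have "\<dots> = (LINT x:k ` T|lborel. (h \<circ> complex_of_vec) x)"
    using H(2) set_borel_integral_eq_integral(2)[OF i1] set_borel_integral_eq_integral(2)[OF i2] by simp
  also have "\<dots> = (LINT z:g ` S|lborel. h z)"
    using set_integrable_complex_of_vec(2)[OF _ h(1)] gS by (simp add: k)
  finally show "(LINT z:S|lborel. ?H z) = (LINT z:g ` S|lborel. h z)" .
qed

section \<open>Power means over discs\<close>

text \<open>Convexity of the power function, obtained from Young's inequality for \<open>v\<close>
  and \<open>c powr (p - 1)\<close>: the conjugate exponent turns the latter into
  \<open>c powr p\<close>.\<close>

lemma powr_above_tangent:
  fixes c v p :: real
  assumes "1 < p" "0 \<le> c" "0 \<le> v"
  shows "c powr p + p * c powr (p - 1) * (v - c) \<le> v powr p"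
proof -
  define q where "q = p / (p - 1)"
  have q: "1 < q" "1 / p + 1 / q = 1" and pq: "(p - 1) * q = p"
    using assms(1) by (auto simp: q_def field_simps)
  have "v * c powr (p - 1) \<le> v powr p / p + (c powr (p - 1)) powr q / q"
    by (rule Youngs_inequality) (use assms q in auto)
  also have "(c powr (p - 1)) powr q / q = c powr p * (p - 1) / p"
    using assms(1) by (simp add: powr_powr pq) (simp add: q_def)
  finally have "p * (v * c powr (p - 1)) \<le> v powr p + c powr p * (p - 1)"
    using assms(1) by (simp add: field_simps)
  moreover have "c powr (p - 1) * c = c powr p"
    using assms by (cases "c = 0") (auto simp: powr_diff)
  ultimately show ?thesis by (simp add: algebra_simps)
qed

text \<open>Jensen's inequality for \<open>u / w\<close> against the measure with density
  \<open>w\<close>, which is Hoelder's inequality with a weight. It serves both the circle means and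
  Hardy's inequality. With an \<open>ennreal\<close> right-hand side, the case of an infinite
  integral is included. Where \<open>w\<close> vanishes, \<open>powr\<close> makes the right-hand
  integrand 0, and \<open>uw\<close> makes the tangent bound 0 as well.\<close>

lemma weighted_power_mean:
  fixes u w :: "'a \<Rightarrow> real"
  assumes p: "1 < p"
    and u: "integrable M u" "\<And>x. x \<in> space M \<Longrightarrow> 0 \<le> u x"
    and w: "integrable M w" "\<And>x. x \<in> space M \<Longrightarrow> 0 \<le> w x" "0 < (\<integral>x. w x \<partial>M)"
    and uw: "\<And>x. x \<in> space M \<Longrightarrow> w x = 0 \<Longrightarrow> u x = 0"
  shows "ennreal ((\<integral>x. u x \<partial>M) powr p)
    \<le> ennreal ((\<integral>x. w x \<partial>M) powr (p - 1)) * (\<integral>\<^sup>+x. ennreal (u x powr p * w x powr (1 - p)) \<partial>M)"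
proof -
  define U A where "U = (\<integral>x. u x \<partial>M)" and "A = (\<integral>x. w x \<partial>M)"
  have A: "0 < A" using w by (simp add: A_def)
  have U: "0 \<le> U" unfolding U_def by (rule Bochner_Integration.integral_nonneg) (use u in auto)
  \<comment> \<open>The tangent is taken at the weighted mean of \<open>u / w\<close>, so that the
    first-order term of \<open>k\<close> integrates to 0.\<close>
  define c where "c = U / A"
  have c: "0 \<le> c" using A U by (simp add: c_def)
  define k where "k x = c powr p * w x + p * c powr (p - 1) * (u x - c * w x)" for x
  have ki: "integrable M k" unfolding k_def using u w by auto
  have "(\<integral>x. k x \<partial>M) = c powr p * A + p * c powr (p - 1) * (U - c * A)"
    unfolding k_def U_def A_def using u w by simp
  also have "\<dots> = U powr p * A powr (1 - p)"
    using A U by (simp add: c_def powr_divide powr_diff)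
  finally have kint: "(\<integral>x. k x \<partial>M) = U powr p * A powr (1 - p)" .
  have kle: "k x \<le> u x powr p * w x powr (1 - p)" if x: "x \<in> space M" for x
  proof (cases "w x = 0")
    case True
    then show ?thesis using uw[OF x] by (simp add: k_def)
  next
    case False
    then have wx: "0 < w x" using w(2)[OF x] by simp
    have "c powr p + p * c powr (p - 1) * (u x / w x - c) \<le> (u x / w x) powr p"
      by (rule powr_above_tangent) (use p c wx u(2)[OF x] in auto)
    then have "w x * (c powr p + p * c powr (p - 1) * (u x / w x - c)) \<le> w x * (u x / w x) powr p"
      using wx by simp
    also have "w x * (u x / w x) powr p = u x powr p * w x powr (1 - p)"
      using wx u(2)[OF x] by (simp add: powr_divide powr_diff)
    also have "w x * (c powr p + p * c powr (p - 1) * (u x / w x - c)) = k x"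
      using wx by (simp add: k_def field_simps)
    finally show ?thesis .
  qed
  \<comment> \<open>\<open>k\<close> may take negative values, so its positive part is used to pass
    to the nonnegative integral.\<close>
  have "ennreal (\<integral>x. k x \<partial>M) \<le> ennreal (\<integral>x. max 0 (k x) \<partial>M)"
    by (intro ennreal_leI integral_mono) (use ki in auto)
  also have "\<dots> = (\<integral>\<^sup>+x. ennreal (max 0 (k x)) \<partial>M)"
    by (intro nn_integral_eq_integral[symmetric]) (use ki in auto)
  also have "\<dots> \<le> (\<integral>\<^sup>+x. ennreal (u x powr p * w x powr (1 - p)) \<partial>M)"
    by (intro nn_integral_mono ennreal_leI) (use kle in auto)
  finally have *: "ennreal (U powr p * A powr (1 - p)) \<le> (\<integral>\<^sup>+x. ennreal (u x powr p * w x powr (1 - p)) \<partial>M)"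
    by (simp add: kint)
  have "U powr p = A powr (p - 1) * (U powr p * A powr (1 - p))"
    using A by (simp add: powr_diff field_simps)
  then have "ennreal (U powr p) = ennreal (A powr (p - 1)) * ennreal (U powr p * A powr (1 - p))"
    by (subst ennreal_mult[symmetric]) auto
  also have "\<dots> \<le> ennreal (A powr (p - 1)) * (\<integral>\<^sup>+x. ennreal (u x powr p * w x powr (1 - p)) \<partial>M)"
    by (rule mult_left_mono[OF *]) simp
  finally show ?thesis by (simp add: U_def A_def)
qed

text \<open>The parameter runs over \<open>{0..1}\<close> as in \<open>circlepath\<close>, so
  Lebesgue measure there is normalised arc length and circle means carry no factor.\<close>

definition unit_circle :: "real \<Rightarrow> complex" where
  "unit_circle t = exp (2 * of_real pi * \<i> * of_real t)"

lemma norm_unit_circle [simp]: "cmod (unit_circle t) = 1"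
  unfolding unit_circle_def using norm_exp_i_times[of "2 * pi * t"] by (simp add: mult_ac)

lemma continuous_on_unit_circle [continuous_intros]:
  "continuous_on A f \<Longrightarrow> continuous_on A (\<lambda>x. unit_circle (f x))"
  unfolding unit_circle_def by (intro continuous_intros)

lemma has_integral_cmul_cancel:
  fixes f :: "real \<Rightarrow> complex"
  assumes "a \<noteq> 0" "((\<lambda>t. a * f t) has_integral a * i) A"
  shows "(f has_integral i) A"
  using has_integral_mult_right[OF assms(2), of "inverse a"] assms(1)
  by (simp only: mult.assoc[symmetric] left_inverse) simp

text \<open>In Cauchy's formula at the centre, the derivative of the circle path is
  \<open>2 * pi * \<i>\<close> times the path itself and cancels the denominator.\<close>

lemma mean_value_unit_circle:
  assumes K: "K holomorphic_on cball 0 1"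
  shows "((\<lambda>t. K (unit_circle t)) has_integral K 0) {0..1}"
proof -
  have "((\<lambda>u. K u / (u - 0)) has_contour_integral (2 * of_real pi * \<i> * K 0)) (circlepath 0 1)"
    by (rule Cauchy_integral_circlepath_simple) (use K in auto)
  then have "((\<lambda>t. K (circlepath 0 1 t) / circlepath 0 1 t *
      vector_derivative (circlepath 0 1) (at t within {0..1})) has_integral 2 * of_real pi * \<i> * K 0) {0..1}"
    by (simp add: has_contour_integral_def)
  then have "((\<lambda>t. (2 * of_real pi * \<i>) * K (unit_circle t)) has_integral 2 * of_real pi * \<i> * K 0) {0..1}"
    by (rule has_integral_eq[rotated])
      (simp add: vector_derivative_circlepath01, simp add: circlepath unit_circle_def)
  then show ?thesis
    by (rule has_integral_cmul_cancel[rotated]) simp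
qed

text \<open>The mean value property and the triangle inequality bound the centre value by the mean
  of the modulus; Jensen with constant weight on \<open>{0..1}\<close> then inserts the
  power.\<close>

lemma power_mean_unit_circle:
  assumes p: "1 < p" and K: "K holomorphic_on cball 0 1"
  shows "ennreal (cmod (K 0) powr p)
    \<le> (\<integral>\<^sup>+t. ennreal (cmod (K (unit_circle t)) powr p) * indicator {0..1} t \<partial>lborel)"
proof -
  have cont: "continuous_on {0..1} (\<lambda>t. K (unit_circle t))"
    by (intro continuous_on_compose2[OF holomorphic_on_imp_continuous_on[OF K]] continuous_intros) auto
  define u where "u t = indicator {0..1} t * cmod (K (unit_circle t))" for t :: real
  have si: "set_integrable lborel {0..1} (\<lambda>t. cmod (K (unit_circle t)))"
    unfolding set_integrable_def
    by (rule borel_integrable_compact) (intro compact_Icc continuous_intros cont)+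
  have "cmod (K 0) = cmod (integral {0..1} (\<lambda>t. K (unit_circle t)))"
    using mean_value_unit_circle[OF K] by (simp add: integral_unique)
  also have "\<dots> \<le> integral {0..1} (\<lambda>t. cmod (K (unit_circle t)))"
    by (intro integral_norm_bound_integral integrable_continuous_real cont continuous_intros) auto
  also have "\<dots> = (\<integral>t. u t \<partial>lborel)"
    using set_borel_integral_eq_integral(2)[OF si] by (simp add: u_def set_lebesgue_integral_def)
  finally have "cmod (K 0) powr p \<le> (\<integral>t. u t \<partial>lborel) powr p"
    using p by (intro powr_mono2) auto
  moreover have "ennreal ((\<integral>t. u t \<partial>lborel) powr p)
    \<le> ennreal ((\<integral>t. indicator {0..1::real} t \<partial>lborel) powr (p - 1)) *
      (\<integral>\<^sup>+t. ennreal (u t powr p * indicator {0..1} t powr (1 - p)) \<partial>lborel)"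
    by (rule weighted_power_mean[OF p])
      (use si in \<open>auto simp: u_def set_integrable_def\<close>)
  \<comment> \<open>Outside \<open>{0..1}\<close> both factors are powers of 0, which
    \<open>powr\<close> evaluates to 0; inside, the weight is 1.\<close>
  moreover have "(\<integral>\<^sup>+t. ennreal (u t powr p * indicator {0..1} t powr (1 - p)) \<partial>lborel)
      = (\<integral>\<^sup>+t. ennreal (cmod (K (unit_circle t)) powr p) * indicator {0..1} t \<partial>lborel)"
    by (intro nn_integral_cong) (auto simp: u_def indicator_def)
  ultimately show ?thesis
    by (simp add: order_trans[OF ennreal_leI])
qed

lemma rotation_image_ball:
  assumes "cmod a = 1"
  shows "(\<lambda>w. c + a * (w - c)) ` ball c r = ball c r"
proof
  show "(\<lambda>w. c + a * (w - c)) ` ball c r \<subseteq> ball c r"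
    using assms by (auto simp: dist_norm norm_mult norm_minus_commute)
  show "ball c r \<subseteq> (\<lambda>w. c + a * (w - c)) ` ball c r"
  proof
    fix z assume "z \<in> ball c r"
    then show "z \<in> (\<lambda>w. c + a * (w - c)) ` ball c r"
      using assms by (intro image_eqI[of _ _ "c + (z - c) / a"])
        (auto simp: dist_norm norm_divide norm_minus_commute)
  qed
qed

text \<open>A rotation about \<open>c\<close> maps the disc onto itself, and its derivative
  \<open>a\<close> has modulus 1, so the Jacobian is 1.\<close>

lemma set_nn_integral_rotation:
  fixes h :: "complex \<Rightarrow> real"
  assumes h: "continuous_on (cball c r) h" "\<And>z. 0 \<le> h z" and a: "cmod a = 1"
  shows "(\<integral>\<^sup>+w\<in>ball c r. ennreal (h (c + a * (w - c))) \<partial>lborel) = (\<integral>\<^sup>+w\<in>ball c r. ennreal (h w) \<partial>lborel)"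
proof -
  have hi: "set_integrable lborel (ball c r) h"
    by (rule set_integrable_subset[of _ "cball c r"])
      (use borel_integrable_compact[OF _ h(1)] in \<open>auto simp: set_integrable_def\<close>)
  have [simp]: "a \<noteq> 0" using a by auto
  have d: "deriv (\<lambda>w. c + a * (w - c)) w = a" for w
    by (auto intro!: DERIV_imp_deriv derivative_eq_intros)
  have hol: "(\<lambda>w. c + a * (w - c)) holomorphic_on ball c r"
    by (intro holomorphic_intros)
  have i: "set_integrable lborel (ball c r) (\<lambda>w. h (c + a * (w - c)))"
    and e: "(LINT w:ball c r|lborel. h (c + a * (w - c))) = (LINT w:ball c r|lborel. h w)"
    using holomorphic_change_of_variables[of "ball c r" "\<lambda>w. c + a * (w - c)" h] hi
      continuous_on_subset[OF h(1) ball_subset_cball] hol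
    by (auto simp: rotation_image_ball[OF a] d a inj_on_def)
  show ?thesis
    using set_nn_integral_eq_set_integral[OF hi] set_nn_integral_eq_set_integral[OF i] h(2) e
    by simp
qed

text \<open>Polar coordinates are avoided: the area integral is invariant under rotations about
  \<open>c\<close>, so it equals its average over all rotations, which is an integral of circle means.\<close>

lemma power_mean_disc:
  assumes p: "1 < p" and r: "0 < r" and F: "F holomorphic_on cball c r"
  shows "ennreal (pi * r\<^sup>2 * cmod (F c) powr p) \<le> (\<integral>\<^sup>+w\<in>ball c r. ennreal (cmod (F w) powr p) \<partial>lborel)"
proof -
  let ?rot = "\<lambda>t w. c + unit_circle t * (w - c)"
  let ?h = "\<lambda>w. cmod (F w) powr p"
  have cF: "continuous_on (cball c r) F"
    using F by (rule holomorphic_on_imp_continuous_on)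
  have ch: "continuous_on (cball c r) ?h"
    by (intro continuous_on_powr' continuous_intros cF) (use p in auto)
  have rot: "dist c (?rot t w) \<le> r" if "dist c w < r" for t w
    using that by (simp add: dist_norm norm_mult norm_minus_commute)
  \<comment> \<open>The circle through \<open>w\<close> about \<open>c\<close> is the image of the
    unit circle under z -> c + z (w - c), a map that sends the closed unit disc into
    \<open>cball c r\<close>.\<close>
  have circle: "ennreal (?h c) \<le> (\<integral>\<^sup>+t\<in>{0..1}. ennreal (?h (?rot t w)) \<partial>lborel)"
    if w: "w \<in> ball c r" for w
  proof -
    have "(\<lambda>z. F (c + z * (w - c))) holomorphic_on cball 0 1"
    proof (rule holomorphic_on_compose_gen[OF _ F, unfolded o_def])
      show "(\<lambda>z. c + z * (w - c)) ` cball 0 1 \<subseteq> cball c r"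
      proof (clarsimp simp: dist_norm norm_mult)
        fix z :: complex assume "cmod z \<le> 1"
        moreover have "cmod (w - c) \<le> r" using w by (simp add: dist_norm norm_minus_commute)
        ultimately show "cmod z * cmod (w - c) \<le> r"
          using mult_mono[of "cmod z" 1 "cmod (w - c)" r] by simp
      qed
    qed (intro holomorphic_intros)
    from power_mean_unit_circle[OF p this] show ?thesis by simp
  qed
  define k where "k t w = ennreal (?h (?rot t w)) * indicator {0..1} t * indicator (ball c r) w" for t w
  have "continuous_on ({0..1} \<times> ball c r) (\<lambda>(t, w). ?h (?rot t w))"
    unfolding case_prod_unfold
    by (intro continuous_on_compose2[OF ch] continuous_intros) (use rot in auto)
  then have "(\<lambda>x. indicator ({0..1} \<times> ball c r) x *\<^sub>R (case x of (t, w) \<Rightarrow> ?h (?rot t w))) \<in> borel_measurable borel"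
    by (intro borel_measurable_continuous_on_indicator) (auto intro!: borel_Times)
  then have "(\<lambda>x. ennreal (indicator ({0..1} \<times> ball c r) x *\<^sub>R (case x of (t, w) \<Rightarrow> ?h (?rot t w)))) \<in> borel_measurable (lborel \<Otimes>\<^sub>M lborel)"
    by (simp add: lborel_prod)
  also have "(\<lambda>x. ennreal (indicator ({0..1} \<times> ball c r) x *\<^sub>R (case x of (t, w) \<Rightarrow> ?h (?rot t w)))) = case_prod k"
    by (auto simp: k_def fun_eq_iff indicator_def)
  finally have km: "case_prod k \<in> borel_measurable (lborel \<Otimes>\<^sub>M lborel)" .
  have "ennreal (pi * r\<^sup>2 * ?h c) = ennreal (?h c) * emeasure lborel (ball c r)"
    using r by (simp add: emeasure_ball unit_ball_vol_2 mult_ac flip: ennreal_mult)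
  also have "\<dots> = (\<integral>\<^sup>+w. ennreal (?h c) * indicator (ball c r) w \<partial>lborel)"
    by (subst nn_integral_cmult_indicator) auto
  also have "\<dots> \<le> (\<integral>\<^sup>+w. \<integral>\<^sup>+t. k t w \<partial>lborel \<partial>lborel)"
  proof (rule nn_integral_mono)
    fix w
    show "ennreal (?h c) * indicator (ball c r) w \<le> (\<integral>\<^sup>+t. k t w \<partial>lborel)"
      using circle[of w] by (cases "w \<in> ball c r") (auto simp: k_def)
  qed
  also have "\<dots> = (\<integral>\<^sup>+t. \<integral>\<^sup>+w. k t w \<partial>lborel \<partial>lborel)"
    by (rule lborel_pair.Fubini'[OF km])
  also have "\<dots> = (\<integral>\<^sup>+t. (\<integral>\<^sup>+w\<in>ball c r. ennreal (?h w) \<partial>lborel) * indicator {0..1::real} t \<partial>lborel)"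
  proof (rule nn_integral_cong)
    fix t :: real
    show "(\<integral>\<^sup>+w. k t w \<partial>lborel) = (\<integral>\<^sup>+w\<in>ball c r. ennreal (?h w) \<partial>lborel) * indicator {0..1} t"
      using set_nn_integral_rotation[OF ch, of "unit_circle t"]
      by (cases "t \<in> {0..1}") (auto simp: k_def)
  qed
  also have "\<dots> = (\<integral>\<^sup>+w\<in>ball c r. ennreal (?h w) \<partial>lborel)"
    by (subst nn_integral_cmult_indicator) auto
  finally show ?thesis .
qed

section \<open>The strip model of the hyperbolic plane\<close>

text \<open>After exchanging the integrals, a point \<open>w\<close> is counted only for centres
  \<open>s\<close> with |s - Re w| < 1, an interval of length 2, and only when |Im w| < 1.\<close>

lemma nn_integral_discs_le_strip:
  fixes k :: "complex \<Rightarrow> ennreal"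
  assumes k: "k \<in> borel_measurable borel"
  shows "(\<integral>\<^sup>+s. (\<integral>\<^sup>+w\<in>ball (of_real s) 1. k w \<partial>lborel) \<partial>lborel)
    \<le> 2 * (\<integral>\<^sup>+w\<in>{w. \<bar>Im w\<bar> < 1}. k w \<partial>lborel)"
proof -
  have "open {x :: real \<times> complex. dist (of_real (fst x)) (snd x) < 1}"
    by (intro open_Collect_less continuous_intros)
  then have "{x :: real \<times> complex. dist (of_real (fst x)) (snd x) < 1} \<in> sets (lborel \<Otimes>\<^sub>M lborel)"
    by (simp only: lborel_prod sets_lborel borel_open)
  moreover have "(\<lambda>x :: real \<times> complex. k (snd x)) \<in> borel_measurable (lborel \<Otimes>\<^sub>M lborel)"
    using k by measurable
  ultimately have "(\<lambda>x. k (snd x) * indicator {x. dist (of_real (fst x)) (snd x) < 1} x)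
      \<in> borel_measurable (lborel \<Otimes>\<^sub>M lborel)"
    by (intro borel_measurable_times_ennreal borel_measurable_indicator)
  also have "(\<lambda>x. k (snd x) * indicator {x. dist (of_real (fst x)) (snd x) < 1} x)
      = (\<lambda>(s, w). k w * indicator (ball (of_real s) 1) w)"
    by (auto simp: fun_eq_iff indicator_def)
  finally have m: "(\<lambda>(s, w). k w * indicator (ball (of_real s) 1) w) \<in> borel_measurable (lborel \<Otimes>\<^sub>M lborel)" .
  have "(\<integral>\<^sup>+s. (\<integral>\<^sup>+w\<in>ball (of_real s) 1. k w \<partial>lborel) \<partial>lborel)
      = (\<integral>\<^sup>+w. \<integral>\<^sup>+s. k w * indicator (ball (of_real s) 1) w \<partial>lborel \<partial>lborel)"
    by (rule lborel_pair.Fubini'[OF m, symmetric])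
  also have "\<dots> \<le> (\<integral>\<^sup>+w. 2 * (k w * indicator {w. \<bar>Im w\<bar> < 1} w) \<partial>lborel)"
  proof (rule nn_integral_mono)
    fix w
    have "indicator (ball (of_real s) 1) w
        \<le> (indicator {w. \<bar>Im w\<bar> < 1} w * indicator {Re w - 1<..<Re w + 1} s :: ennreal)" for s
      using abs_Re_le_cmod[of "of_real s - w"] abs_Im_le_cmod[of "of_real s - w"]
      by (auto simp: indicator_def dist_norm)
    then have "(\<integral>\<^sup>+s. k w * indicator (ball (of_real s) 1) w \<partial>lborel)
        \<le> (\<integral>\<^sup>+s. (k w * indicator {w. \<bar>Im w\<bar> < 1} w) * indicator {Re w - 1<..<Re w + 1} s \<partial>lborel)"
      by (intro nn_integral_mono) (simp add: mult.assoc mult_left_mono)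
    also have "\<dots> = (k w * indicator {w. \<bar>Im w\<bar> < 1} w) * 2"
      by (subst nn_integral_cmult_indicator) auto
    finally show "(\<integral>\<^sup>+s. k w * indicator (ball (of_real s) 1) w \<partial>lborel) \<le> 2 * (k w * indicator {w. \<bar>Im w\<bar> < 1} w)"
      by (simp add: mult.commute)
  qed
  also have "\<dots> = 2 * (\<integral>\<^sup>+w\<in>{w. \<bar>Im w\<bar> < 1}. k w \<partial>lborel)"
  proof (rule nn_integral_cmult)
    have "{w. \<bar>Im w\<bar> < 1} \<in> sets borel"
      by (intro borel_open open_Collect_less continuous_intros)
    then show "(\<lambda>w. k w * indicator {w. \<bar>Im w\<bar> < 1} w) \<in> borel_measurable lborel"
      using k by (intro borel_measurable_times_ennreal borel_measurable_indicator) auto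
  qed
  finally show ?thesis .
qed

definition hyp_strip :: "complex set" where
  "hyp_strip = {w. \<bar>Im w\<bar> < pi / 2}"

text \<open>This is tanh (w / 2), the inverse of log ((1 + z) / (1 - z)).\<close>

definition strip_to_disc :: "complex \<Rightarrow> complex" where
  "strip_to_disc w = (exp w - 1) / (exp w + 1)"

lemma open_hyp_strip: "open hyp_strip"
  unfolding hyp_strip_def by (intro open_Collect_less continuous_intros)

lemma cos_Im_pos: "w \<in> hyp_strip \<Longrightarrow> 0 < cos (Im w)"
  by (intro cos_gt_zero_pi) (auto simp: hyp_strip_def)

lemma exp_plus_one_nonzero: "w \<in> hyp_strip \<Longrightarrow> exp w + 1 \<noteq> 0"
  using cos_Im_pos[of w] by (auto simp: complex_eq_iff Re_exp add_pos_pos order_less_imp_not_eq2)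

lemma strip_to_disc_has_field_derivative:
  assumes "w \<in> hyp_strip"
  shows "(strip_to_disc has_field_derivative 2 * exp w / (exp w + 1)\<^sup>2) (at w)"
  unfolding strip_to_disc_def using exp_plus_one_nonzero[OF assms]
  by (auto intro!: derivative_eq_intros simp: divide_simps power2_eq_square algebra_simps)

lemma one_minus_norm_strip_to_disc:
  assumes "w \<in> hyp_strip"
  shows "1 - (cmod (strip_to_disc w))\<^sup>2 = 4 * exp (Re w) * cos (Im w) / (cmod (exp w + 1))\<^sup>2"
proof -
  have "(cmod (exp w + 1))\<^sup>2 - (cmod (exp w - 1))\<^sup>2 = 4 * Re (exp w)"
    unfolding cmod_power2 by (simp add: power2_eq_square algebra_simps)
  then show ?thesis
    using exp_plus_one_nonzero[OF assms]
    by (simp add: strip_to_disc_def norm_divide power_divide Re_exp divide_simps)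
qed

lemma norm_strip_to_disc_less_1:
  assumes "w \<in> hyp_strip"
  shows "cmod (strip_to_disc w) < 1"
proof -
  have "0 < 1 - (cmod (strip_to_disc w))\<^sup>2"
    unfolding one_minus_norm_strip_to_disc[OF assms]
    using cos_Im_pos[OF assms] exp_plus_one_nonzero[OF assms] by simp
  then show ?thesis by (simp add: abs_square_less_1)
qed

text \<open>A Moebius map is injective, and \<open>exp\<close> is injective on the strip because its
  height pi is less than 2 pi.\<close>

lemma inj_on_strip_to_disc: "inj_on strip_to_disc hyp_strip"
proof (rule inj_onI)
  fix v w assume vw: "v \<in> hyp_strip" "w \<in> hyp_strip" "strip_to_disc v = strip_to_disc w"
  then have "(exp v - 1) * (exp w + 1) = (exp w - 1) * (exp v + 1)"
    using exp_plus_one_nonzero by (simp add: strip_to_disc_def frac_eq_eq)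
  then have "exp v = exp w" by (simp add: algebra_simps)
  moreover have "\<bar>Im v - Im w\<bar> < 2 * pi"
    using vw by (auto simp: hyp_strip_def)
  ultimately show "v = w"
    by (auto intro: exp_complex_eqI)
qed

text \<open>The left-hand side is the hyperbolic density pulled back to the strip. It equals 1 on
  the real axis, so the diameter is parametrised there by hyperbolic length.\<close>

lemma hyp_density_strip_to_disc:
  assumes "w \<in> hyp_strip"
  shows "hyp_density (strip_to_disc w) * cmod (2 * exp w / (exp w + 1)\<^sup>2) = 1 / cos (Im w)"
  unfolding hyp_density_def one_minus_norm_strip_to_disc[OF assms]
  using exp_plus_one_nonzero[OF assms] cos_Im_pos[OF assms]
  by (simp add: norm_divide norm_mult norm_power divide_simps)

text \<open>Since 1 < pi / 3, the cosine is at least 1/2. For p >= 2 the right-hand side is 4 times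
  a power of 2 cos y >= 1 with nonnegative exponent; for p < 2 the exponent of the cosine is
  negative, so that factor is at least 1. The 2 on the left is the overlap constant of the
  discs.\<close>

lemma two_le_strip_weight:
  fixes p y :: real
  assumes "1 < p" "\<bar>y\<bar> < 1"
  shows "2 \<le> 2 powr p * cos y powr (p - 2)"
proof -
  have "cos (pi / 3) \<le> cos \<bar>y\<bar>"
    by (rule cos_monotone_0_pi_le) (use assms pi_gt3 in auto)
  then have c: "1 / 2 \<le> cos y" by (simp add: cos_60)
  show ?thesis
  proof (cases "2 \<le> p")
    case True
    have "2 powr p * cos y powr (p - 2) = 4 * (2 * cos y) powr (p - 2)"
      using c by (simp add: powr_mult powr_diff)
    moreover have "1 \<le> (2 * cos y) powr (p - 2)"
      using True c by (intro ge_one_powr_ge_zero) auto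
    ultimately show ?thesis by simp
  next
    case False
    have "1 \<le> cos y powr (p - 2)"
      using False c powr_mono2'[of "p - 2" "cos y" 1] by simp
    moreover have "2 powr 1 \<le> 2 powr p"
      by (rule powr_mono) (use assms in auto)
    ultimately show ?thesis
      using mult_mono[of 2 "2 powr p" 1 "cos y powr (p - 2)"] by simp
  qed
qed

text \<open>The derivative of \<open>f\<close> composed with the rotated map
  \<open>strip_to_disc\<close>, without the unimodular factor \<open>cis \<theta>\<close>, since
  only its modulus matters.\<close>

definition strip_deriv :: "(complex \<Rightarrow> complex) \<Rightarrow> real \<Rightarrow> complex \<Rightarrow> complex" where
  "strip_deriv f \<theta> w = deriv f (cis \<theta> * strip_to_disc w) * (2 * exp w / (exp w + 1)\<^sup>2)"

lemma strip_deriv_holomorphic: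
  assumes "f holomorphic_on ball 0 1"
  shows "strip_deriv f \<theta> holomorphic_on hyp_strip"
proof -
  have "strip_to_disc holomorphic_on hyp_strip"
    using strip_to_disc_has_field_derivative by (auto simp: holomorphic_on_open[OF open_hyp_strip])
  then have "(\<lambda>w. cis \<theta> * strip_to_disc w) holomorphic_on hyp_strip"
    by (intro holomorphic_intros)
  moreover have "deriv f holomorphic_on ball 0 1"
    using assms by (intro holomorphic_deriv) auto
  ultimately have "(\<lambda>w. deriv f (cis \<theta> * strip_to_disc w)) holomorphic_on hyp_strip"
    using holomorphic_on_compose_gen norm_strip_to_disc_less_1
    by (fastforce simp: o_def image_subset_iff norm_mult)
  then show ?thesis
    unfolding strip_deriv_def by (intro holomorphic_intros) (auto simp: exp_plus_one_nonzero)
qed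

lemma continuous_on_strip_deriv_powr:
  assumes "0 < p" "f holomorphic_on ball 0 1"
  shows "continuous_on hyp_strip (\<lambda>w. cmod (strip_deriv f \<theta> w) powr p)"
  using assms(1) holomorphic_on_imp_continuous_on[OF strip_deriv_holomorphic[OF assms(2)]]
  by (intro continuous_on_powr' continuous_intros) auto

text \<open>The real line is the full diameter in direction \<open>\<theta>\<close>. In the
  constant, 1 / pi comes from the area of the unit disc and \<open>2 powr p\<close> from
  \<open>two_le_strip_weight\<close>, which absorbs the overlap factor 2.\<close>

lemma nn_integral_diameter_le:
  fixes p \<theta> :: real and f :: "complex \<Rightarrow> complex"
  defines "F \<equiv> strip_deriv f \<theta>"
  assumes p: "1 < p" and f: "f \<in> Lambda_space p"
  shows "(\<integral>\<^sup>+s. ennreal (cmod (F (of_real s)) powr p) \<partial>lborel)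
    \<le> ennreal (2 powr p / pi * (LINT z:ball 0 1|lborel. Lambda_integrand p f z))"
proof -
  define G where "G w = cis \<theta> * strip_to_disc w" for w
  have G': "(G has_field_derivative cis \<theta> * (2 * exp w / (exp w + 1)\<^sup>2)) (at w)" if "w \<in> hyp_strip" for w
    unfolding G_def by (rule DERIV_cmult[OF strip_to_disc_has_field_derivative[OF that]])
  have GH: "G holomorphic_on hyp_strip"
    using G' by (auto simp: holomorphic_on_open[OF open_hyp_strip])
  have Gball: "G w \<in> ball 0 1" if "w \<in> hyp_strip" for w
    using norm_strip_to_disc_less_1[OF that] by (simp add: G_def norm_mult)
  have Ginj: "inj_on G hyp_strip"
    using inj_on_strip_to_disc by (auto simp: G_def inj_on_def)
  have f_hol: "f holomorphic_on ball 0 1"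
    and f_int: "set_integrable lborel (ball 0 1) (Lambda_integrand p f)"
    using f by (auto simp: Lambda_space_def)
  have f'_hol: "deriv f holomorphic_on ball 0 1"
    using f_hol by (intro holomorphic_deriv) auto
  have F_hol: "F holomorphic_on hyp_strip"
    unfolding F_def by (rule strip_deriv_holomorphic[OF f_hol])
  \<comment> \<open>With d the modulus of G', the density at \<open>G w\<close> is 1 / (d cos (Im
    w)). So |f'| divided by the density is |F| cos (Im w), and d^2 times the squared density leaves
    cos (Im w) to the power -2.\<close>
  have Lambda: "(cmod (deriv G w))\<^sup>2 * Lambda_integrand p f (G w)
      = cmod (F w) powr p * cos (Im w) powr (p - 2)" if w: "w \<in> hyp_strip" for w
  proof -
    define d where "d = cmod (2 * exp w / (exp w + 1)\<^sup>2)"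
    have dG: "cmod (deriv G w) = d"
      unfolding DERIV_imp_deriv[OF G'[OF w]] by (simp add: d_def norm_mult norm_divide)
    have "hyp_density (G w) = hyp_density (strip_to_disc w)"
      by (simp add: hyp_density_def G_def norm_mult)
    then have ld: "hyp_density (G w) * d = 1 / cos (Im w)"
      using hyp_density_strip_to_disc[OF w] by (simp add: d_def)
    have d0: "d > 0" using exp_plus_one_nonzero[OF w] by (simp add: d_def)
    have c0: "cos (Im w) > 0" by (rule cos_Im_pos[OF w])
    have l: "hyp_density (G w) = 1 / (cos (Im w) * d)"
      using ld d0 c0 by (simp add: field_simps)
    have "cmod (F w) = cmod (deriv f (G w)) * d"
      by (simp add: F_def strip_deriv_def G_def d_def norm_mult norm_divide)
    then have quot: "cmod (deriv f (G w)) / hyp_density (G w) = cmod (F w) * cos (Im w)"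
      by (simp add: l)
    show ?thesis
      unfolding Lambda_integrand_def dG quot
      using d0 c0 by (simp add: l powr_mult powr_diff power_divide power_mult_distrib)
  qed
  \<comment> \<open>\<open>F\<close> is controlled only on the strip; cutting off there gives a
    Borel function on the whole plane.\<close>
  let ?k = "\<lambda>w. ennreal (cmod (F w) powr p) * indicator hyp_strip w"
  have cont: "continuous_on hyp_strip (\<lambda>w. cmod (F w) powr p)"
    unfolding F_def by (rule continuous_on_strip_deriv_powr) (use p f_hol in auto)
  have "(\<lambda>w. ennreal (indicator hyp_strip w *\<^sub>R cmod (F w) powr p)) \<in> borel_measurable borel"
    using borel_measurable_continuous_on_indicator[OF _ cont] open_hyp_strip by simp
  also have "(\<lambda>w. ennreal (indicator hyp_strip w *\<^sub>R cmod (F w) powr p)) = ?k"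
    by (auto simp: fun_eq_iff indicator_def)
  finally have km: "?k \<in> borel_measurable borel" .
  have disc: "ennreal (pi * cmod (F (of_real s)) powr p) \<le> (\<integral>\<^sup>+w\<in>ball (of_real s) 1. ?k w \<partial>lborel)" for s
  proof -
    \<comment> \<open>Radius 1 is admissible because 1 < pi / 2: closed unit discs about real points
      stay inside the strip.\<close>
    have sub: "cball (of_real s) 1 \<subseteq> hyp_strip"
    proof
      fix w assume "w \<in> cball (of_real s :: complex) 1"
      then have "\<bar>Im w\<bar> \<le> 1"
        using abs_Im_le_cmod[of "of_real s - w"] by (simp add: dist_norm)
      then show "w \<in> hyp_strip" using pi_gt3 by (simp add: hyp_strip_def)
    qed
    have "ennreal (pi * cmod (F (of_real s)) powr p)
        \<le> (\<integral>\<^sup>+w\<in>ball (of_real s) 1. ennreal (cmod (F w) powr p) \<partial>lborel)"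
      using power_mean_disc[OF p zero_less_one holomorphic_on_subset[OF F_hol sub]] by simp
    also have "\<dots> = (\<integral>\<^sup>+w\<in>ball (of_real s) 1. ?k w \<partial>lborel)"
      by (intro nn_integral_cong) (use subsetD[OF sub] in \<open>force simp: indicator_def\<close>)
    finally show ?thesis .
  qed
  have "open (G ` hyp_strip)"
    using open_mapping_thm3 GH open_hyp_strip Ginj by blast
  moreover have Gsub: "G ` hyp_strip \<subseteq> ball 0 1" using Gball by blast
  ultimately have iG: "set_integrable lborel (G ` hyp_strip) (Lambda_integrand p f)"
    by (intro set_integrable_subset[OF f_int]) auto
  have "continuous_on (ball 0 1) (Lambda_integrand p f)"
  proof -
    have sq: "(cmod z)\<^sup>2 < 1" if "z \<in> ball 0 1" for z :: complex
      using that by (simp add: abs_square_less_1)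
    have cd: "continuous_on (ball 0 1) hyp_density"
      unfolding hyp_density_def by (intro continuous_intros) (use sq in fastforce)
    have pos: "0 < hyp_density z" if "z \<in> ball 0 1" for z
      using sq[OF that] by (simp add: hyp_density_def)
    have "continuous_on (ball 0 1) (\<lambda>z. cmod (deriv f z) / hyp_density z)"
      using pos by (intro continuous_intros cd holomorphic_on_imp_continuous_on[OF f'_hol]) force
    then show ?thesis
      unfolding Lambda_integrand_def using p pos
      by (intro continuous_on_mult continuous_on_powr' continuous_on_power cd continuous_on_const)
        (auto simp: less_imp_le)
  qed
  note cov = holomorphic_change_of_variables[OF open_hyp_strip GH Ginj
      continuous_on_subset[OF this Gsub] iG]
  have Lnn: "0 \<le> Lambda_integrand p f z" for z by (simp add: Lambda_integrand_def)
  have "ennreal pi * (\<integral>\<^sup>+s. ennreal (cmod (F (of_real s)) powr p) \<partial>lborel)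
      = (\<integral>\<^sup>+s. ennreal (pi * cmod (F (of_real s)) powr p) \<partial>lborel)"
  proof (subst nn_integral_cmult[symmetric])
    have "continuous_on UNIV (\<lambda>s :: real. cmod (F (of_real s)) powr p)"
      by (intro continuous_on_compose2[OF cont] continuous_intros) (auto simp: hyp_strip_def)
    then show "(\<lambda>s :: real. ennreal (cmod (F (of_real s)) powr p)) \<in> borel_measurable lborel"
      using borel_measurable_continuous_onI by auto
  qed (simp add: ennreal_mult)
  also have "\<dots> \<le> (\<integral>\<^sup>+s. (\<integral>\<^sup>+w\<in>ball (of_real s) 1. ?k w \<partial>lborel) \<partial>lborel)"
    by (intro nn_integral_mono disc)
  also have "\<dots> \<le> 2 * (\<integral>\<^sup>+w\<in>{w. \<bar>Im w\<bar> < 1}. ?k w \<partial>lborel)"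
    by (rule nn_integral_discs_le_strip[OF km])
  also have "\<dots> = (\<integral>\<^sup>+w. 2 * (?k w * indicator {w. \<bar>Im w\<bar> < 1} w) \<partial>lborel)"
  proof (rule nn_integral_cmult[symmetric])
    have "{w. \<bar>Im w\<bar> < 1} \<in> sets borel"
      by (intro borel_open open_Collect_less continuous_intros)
    then have "(\<lambda>w. ?k w * indicator {w. \<bar>Im w\<bar> < 1} w) \<in> borel_measurable borel"
      by (intro borel_measurable_times_ennreal[OF km] borel_measurable_indicator)
    then show "(\<lambda>w. ?k w * indicator {w. \<bar>Im w\<bar> < 1} w) \<in> borel_measurable lborel"
      by simp
  qed
  also have "\<dots> \<le> (\<integral>\<^sup>+w\<in>hyp_strip. ennreal (2 powr p * ((cmod (deriv G w))\<^sup>2 * Lambda_integrand p f (G w))) \<partial>lborel)"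
  proof (rule nn_integral_mono)
    fix w
    show "2 * (?k w * indicator {w. \<bar>Im w\<bar> < 1} w)
      \<le> ennreal (2 powr p * ((cmod (deriv G w))\<^sup>2 * Lambda_integrand p f (G w))) * indicator hyp_strip w"
    proof (cases "w \<in> hyp_strip \<and> \<bar>Im w\<bar> < 1")
      case True
      then have "2 * cmod (F w) powr p \<le> (2 powr p * cos (Im w) powr (p - 2)) * cmod (F w) powr p"
        by (intro mult_right_mono two_le_strip_weight[OF p]) auto
      also have "\<dots> = 2 powr p * ((cmod (deriv G w))\<^sup>2 * Lambda_integrand p f (G w))"
        using Lambda True by simp
      finally have "ennreal (2 * cmod (F w) powr p) \<le> ennreal (2 powr p * ((cmod (deriv G w))\<^sup>2 * Lambda_integrand p f (G w)))"
        by (rule ennreal_leI)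
      then show ?thesis using True by (simp add: ennreal_mult)
    qed (auto simp: indicator_def)
  qed
  also have "\<dots> = ennreal (LINT w:hyp_strip|lborel. 2 powr p * ((cmod (deriv G w))\<^sup>2 * Lambda_integrand p f (G w)))"
    by (rule set_nn_integral_eq_set_integral) (use cov(1) Lnn in auto)
  also have "\<dots> = ennreal (2 powr p * (LINT z:G ` hyp_strip|lborel. Lambda_integrand p f z))"
    by (simp add: cov(2))
  \<comment> \<open>The integrand is nonnegative, so it suffices that the image of \<open>G\<close>
    lies in the disc.\<close>
  also have "\<dots> \<le> ennreal (2 powr p * (LINT z:ball 0 1|lborel. Lambda_integrand p f z))"
    unfolding set_lebesgue_integral_def
    using f_int iG Lnn Gsub
    by (intro ennreal_leI mult_left_mono integral_mono) (auto simp: set_integrable_def indicator_def)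
  also have "\<dots> = ennreal pi * ennreal (2 powr p / pi * (LINT z:ball 0 1|lborel. Lambda_integrand p f z))"
    using Lnn by (simp add: set_lebesgue_integral_def integral_nonneg flip: ennreal_mult)
  finally show ?thesis
    by (subst (asm) ennreal_mult_le_mult_iff) auto
qed

section \<open>Hardy's inequality\<close>

text \<open>One-sided limits of the antiderivative take the place of continuity at the endpoints.
  This covers weights that may blow up at 0 and tail integrals up to 1, with integrability coming
  from nonnegativity.\<close>

lemma FTC_nonneg_Ioo:
  fixes f F :: "real \<Rightarrow> real"
  assumes "a < b"
    and F: "\<And>x. a < x \<Longrightarrow> x < b \<Longrightarrow> DERIV F x :> f x"
    and f: "\<And>x. a < x \<Longrightarrow> x < b \<Longrightarrow> isCont f x" "\<And>x. a < x \<Longrightarrow> x < b \<Longrightarrow> 0 \<le> f x"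
    and lim: "(F \<longlongrightarrow> A) (at_right a)" "(F \<longlongrightarrow> B) (at_left b)"
  shows "set_integrable lborel {a<..<b} f" and "(LINT x:{a<..<b}|lborel. f x) = B - A"
proof -
  have *: "set_integrable lborel (einterval (ereal a) (ereal b)) f"
    "(LBINT x=ereal a..ereal b. f x) = B - A"
    by (rule interval_integral_FTC_nonneg[where F = F];
        use assms in \<open>auto simp: ereal_tendsto_simps\<close>)+
  then show "set_integrable lborel {a<..<b} f" "(LINT x:{a<..<b}|lborel. f x) = B - A"
    using \<open>a < b\<close> by (simp_all add: interval_integral_Ioo)
qed

text \<open>With respect to \<open>dL\<close> this is the classical Hardy inequality for \<open>u / l\<close>. Hoelder's
  inequality is applied with weight \<open>L powr (-1 / p)\<close>, the choice that yields the sharp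
  constant.\<close>

lemma Hardy_inequality_substituted:
  fixes u l L :: "real \<Rightarrow> real"
  assumes p: "1 < p" and pq: "1 / p + 1 / q = 1"
    and u: "continuous_on {0..<1} u" "\<And>t. 0 \<le> u t"
    and L: "\<And>t. 0 < t \<Longrightarrow> t < 1 \<Longrightarrow> DERIV L t :> l t"
      "\<And>t. 0 < t \<Longrightarrow> t < 1 \<Longrightarrow> isCont l t"
      "\<And>t. 0 < t \<Longrightarrow> t < 1 \<Longrightarrow> 0 < l t"
      "\<And>t. 0 < t \<Longrightarrow> t < 1 \<Longrightarrow> 0 < L t"
    and lim: "(L \<longlongrightarrow> 0) (at_right 0)" "filterlim L at_top (at_left 1)"
  shows "(\<integral>\<^sup>+r\<in>{0<..<1}. ennreal (((LINT t:{0..r}|lborel. u t) / L r) powr p * l r) \<partial>lborel)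
    \<le> ennreal (q powr p) * (\<integral>\<^sup>+t\<in>{0<..<1}. ennreal (u t powr p * l t powr (1 - p)) \<partial>lborel)"
proof -
  have q: "q = p / (p - 1)"
  proof -
    have "q \<noteq> 0" using pq p by auto
    then show ?thesis using pq p by (simp add: field_simps)
  qed
  have q1: "1 < q" using p by (simp add: q field_simps)
  \<comment> \<open>\<open>w\<close> is the Hoelder weight, the derivative of
    \<open>q * L powr (1 / q)\<close>. For fixed \<open>r\<close>, Hoelder's bound then factors into
    \<open>a r\<close>, which gathers the outer quantities, and \<open>b t\<close>, the integrand in
    the inner variable.\<close>
  define w where "w t = L t powr (- 1 / p) * l t" for t
  define a where "a r = q powr (p - 1) * L r powr (- 1 - 1 / q) * l r" for r
  define b where "b t = u t powr p * L t powr (1 / q) * l t powr (1 - p)" for t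
  have contL: "isCont L t" if "0 < t" "t < 1" for t
    using L(1)[OF that] by (rule DERIV_isCont)
  have ucont: "continuous_on {0..r} u" if "r < 1" for r
    by (rule continuous_on_subset[OF u(1)]) (use that in auto)

  have contLpow: "isCont (\<lambda>t. L t powr e) t" if "0 < t" "t < 1" for t e
    using that L(4)[of t] by (intro continuous_intros contL) auto
  have contlpow: "isCont (\<lambda>t. l t powr e) t" if "0 < t" "t < 1" for t e
    using that L(3)[of t] by (intro continuous_intros L(2)) auto
  have cont_a: "continuous_on {0<..<1} a"
    unfolding a_def
    by (intro continuous_at_imp_continuous_on ballI continuous_intros contLpow L(2)) auto
  have cont_b: "continuous_on {0<..<1} b"
    unfolding b_def
  proof (intro continuous_on_mult)
    show "continuous_on {0<..<1} (\<lambda>t. u t powr p)"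
      using p by (intro continuous_on_powr' continuous_intros continuous_on_subset[OF u(1)]) (auto simp: u)
    show "continuous_on {0<..<1} (\<lambda>t. L t powr (1 / q))" "continuous_on {0<..<1} (\<lambda>t. l t powr (1 - p))"
      by (intro continuous_at_imp_continuous_on ballI contLpow contlpow; simp)+
  qed
  have meas: "(\<lambda>t. ennreal (h t) * indicator A t) \<in> borel_measurable lborel"
    if "continuous_on A h" "A \<in> sets borel" for h :: "real \<Rightarrow> real" and A
  proof -
    have "(\<lambda>t. ennreal (indicator A t *\<^sub>R h t)) \<in> borel_measurable borel"
      using that by (intro measurable_compose[OF _ measurable_ennreal] borel_measurable_continuous_on_indicator)
    also have "(\<lambda>t. ennreal (indicator A t *\<^sub>R h t)) = (\<lambda>t. ennreal (h t) * indicator A t)"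
      by (auto simp: fun_eq_iff indicator_def)
    finally show ?thesis by simp
  qed

  \<comment> \<open>The primitive vanishes at 0 because \<open>L\<close> tends to 0 there and its
    exponent 1/q is positive.\<close>
  have w_int: "set_integrable lborel {0<..<r} w" "(LINT t:{0<..<r}|lborel. w t) = q * L r powr (1 / q)"
    if r: "0 < r" "r < 1" for r
  proof -
    have D: "DERIV (\<lambda>t. q * L t powr (1 / q)) t :> w t" if "0 < t" "t < r" for t
    proof -
      have e: "1 / q - 1 = - 1 / p" using pq by simp
      have "DERIV (\<lambda>t. q * L t powr (1 / q)) t :> q * (1 / q * L t powr (1 / q - 1) * l t)"
        using DERIV_cmult[OF DERIV_fun_powr[OF L(1) L(4)], of t q "1 / q"] that r by simp
      then show ?thesis using q1 by (simp add: w_def e)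
    qed
    have C: "isCont w t" if "0 < t" "t < r" for t
      unfolding w_def using that r L(4)[of t] by (intro continuous_intros L contL) auto
    have P: "0 \<le> w t" if "0 < t" "t < r" for t
      unfolding w_def using that r L(3)[of t] by simp
    have "((\<lambda>t. L t powr (1 / q)) \<longlongrightarrow> 0) (at_right 0)"
    proof (rule tendsto_zero_powrI[OF lim(1)])
      show "\<forall>\<^sub>F t in at_right 0. 0 \<le> L t"
        using L(4) by (auto simp: eventually_at_right_field less_imp_le intro!: exI[of _ 1])
    qed (use q1 in auto)
    then have l0: "((\<lambda>t. q * L t powr (1 / q)) \<longlongrightarrow> 0) (at_right 0)"
      by (rule tendsto_mult_right_zero)
    have "isCont (\<lambda>t. q * L t powr (1 / q)) r"
      using r L(4)[OF r] by (intro continuous_intros contL) auto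
    then have l1: "((\<lambda>t. q * L t powr (1 / q)) \<longlongrightarrow> q * L r powr (1 / q)) (at_left r)"
      by (simp add: isCont_def filterlim_at_split)
    show "set_integrable lborel {0<..<r} w" "(LINT t:{0<..<r}|lborel. w t) = q * L r powr (1 / q)"
      using FTC_nonneg_Ioo[OF r(1) D C P l0 l1] by auto
  qed

  \<comment> \<open>The primitive tends to 0 at 1 because \<open>L\<close> tends to infinity. The
    remaining \<open>L t powr (- 1 / q)\<close> will cancel the power of \<open>L t\<close> in
    \<open>b t\<close>, leaving the constant \<open>q powr p\<close>.\<close>
  have a_int: "(\<integral>\<^sup>+r\<in>{t<..<1}. ennreal (a r) \<partial>lborel) = ennreal (q powr p * L t powr (- 1 / q))"
    if t: "0 < t" "t < 1" for t
  proof -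
    have D: "DERIV (\<lambda>r. - (q powr p) * L r powr (- 1 / q)) r :> a r" if "t < r" "r < 1" for r
    proof -
      have "DERIV (\<lambda>r. - (q powr p) * L r powr (- 1 / q)) r :> - (q powr p) * (- 1 / q * L r powr (- 1 / q - 1) * l r)"
        using DERIV_cmult[OF DERIV_fun_powr[OF L(1) L(4)], of r "- (q powr p)" "- 1 / q"] that t by simp
      moreover have "- (q powr p) * (- 1 / q * L r powr (- 1 / q - 1) * l r)
          = (q powr p * (1 / q)) * L r powr (- 1 / q - 1) * l r"
        by simp
      moreover have "- 1 / q - 1 = - 1 - 1 / q" by simp
      moreover have "q powr p * (1 / q) = q powr (p - 1)"
        using q1 by (simp add: powr_diff)
      ultimately show ?thesis by (simp only: a_def)
    qed
    have C: "isCont a r" if "t < r" "r < 1" for r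
      unfolding a_def using that t L(4)[of r] by (intro continuous_intros L contL) auto
    have P: "0 \<le> a r" if "t < r" "r < 1" for r
      unfolding a_def using that t L(3)[of r] by simp
    have "isCont (\<lambda>r. - (q powr p) * L r powr (- 1 / q)) t"
      using t L(4)[OF t] by (intro continuous_intros contL) auto
    then have l0: "((\<lambda>r. - (q powr p) * L r powr (- 1 / q)) \<longlongrightarrow> - (q powr p) * L t powr (- 1 / q)) (at_right t)"
      by (simp add: isCont_def filterlim_at_split)
    have "((\<lambda>r. L r powr (- 1 / q)) \<longlongrightarrow> 0) (at_left 1)"
      by (rule tendsto_neg_powr[OF _ lim(2)]) (use q1 in auto)
    then have l1: "((\<lambda>r. - (q powr p) * L r powr (- 1 / q)) \<longlongrightarrow> 0) (at_left 1)"
      by (rule tendsto_mult_right_zero)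
    show ?thesis
      using FTC_nonneg_Ioo[OF t(2) D C P l0 l1] P
      by (subst set_nn_integral_eq_set_integral) auto
  qed

  \<comment> \<open>The weighted power mean for \<open>u\<close> and \<open>w\<close> on (0, r),
    multiplied by \<open>L r powr (- p) * l r\<close>. The total weight contributes
    \<open>L r\<close> to the power (p - 1) / q, and (p - 1) / q - p = -1 - 1/q is the exponent in
    \<open>a\<close>.\<close>
  have U: "ennreal (((LINT t:{0..r}|lborel. u t) / L r) powr p * l r)
      \<le> (\<integral>\<^sup>+t\<in>{0<..<r}. ennreal (a r * b t) \<partial>lborel)" if r: "0 < r" "r < 1" for r
  proof -
    define U where "U = (LINT t:{0..r}|lborel. u t)"
    define A where "A = (q * L r powr (1 / q)) powr (p - 1)"
    have u0: "set_integrable lborel {0..r} u"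
      unfolding set_integrable_def by (intro borel_integrable_compact ucont r) auto
    then have ui: "set_integrable lborel {0<..<r} u"
      by (rule set_integrable_subset) auto
    have Ueq: "U = (\<integral>t. indicator {0<..<r} t * u t \<partial>lborel)"
      using interval_integral_Icc[of 0 r u] interval_integral_Ioo[of 0 r u] r
      by (simp add: U_def set_lebesgue_integral_def zero_ereal_def)
    have U0: "0 \<le> U"
      unfolding Ueq by (rule Bochner_Integration.integral_nonneg) (simp add: u)
    have wpos: "0 < w t" if "0 < t" "t < r" for t
      using that r L(3,4)[of t] by (simp add: w_def)
    have "ennreal (U powr p) \<le> ennreal ((\<integral>t. indicator {0<..<r} t * w t \<partial>lborel) powr (p - 1)) *
      (\<integral>\<^sup>+t. ennreal ((indicator {0<..<r} t * u t) powr p * (indicator {0<..<r} t * w t) powr (1 - p)) \<partial>lborel)"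
      unfolding Ueq
    proof (rule weighted_power_mean[OF p])
      show "0 < (\<integral>t. indicator {0<..<r} t * w t \<partial>lborel)"
        using w_int(2)[OF r] q1 L(4)[OF r] by (simp add: set_lebesgue_integral_def)
      show "0 \<le> indicator {0<..<r} t * w t" for t
        using wpos[of t] by (auto simp: indicator_def)
      show "indicator {0<..<r} t * u t = 0" if "indicator {0<..<r} t * w t = 0" for t
        using wpos[of t] that by (auto simp: indicator_def split: if_splits)
    qed (use ui w_int(1)[OF r] u(2) in \<open>auto simp: set_integrable_def\<close>)
    also have "(\<integral>t. indicator {0<..<r} t * w t \<partial>lborel) powr (p - 1) = A"
      using w_int(2)[OF r] by (simp add: set_lebesgue_integral_def A_def)
    also have "(\<integral>\<^sup>+t. ennreal ((indicator {0<..<r} t * u t) powr p * (indicator {0<..<r} t * w t) powr (1 - p)) \<partial>lborel)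
        = (\<integral>\<^sup>+t\<in>{0<..<r}. ennreal (b t) \<partial>lborel)"
    proof (rule nn_integral_cong)
      fix t
      show "ennreal ((indicator {0<..<r} t * u t) powr p * (indicator {0<..<r} t * w t) powr (1 - p))
        = ennreal (b t) * indicator {0<..<r} t"
      proof (cases "0 < t \<and> t < r")
        case True
        have "- 1 / p * (1 - p) = 1 / q" using p by (simp add: q field_simps)
        then have "w t powr (1 - p) = L t powr (1 / q) * l t powr (1 - p)"
          using True r L(3,4)[of t] by (simp add: w_def powr_mult powr_powr)
        then show ?thesis using True by (simp add: b_def mult.assoc)
      qed (auto simp: indicator_def)
    qed
    finally have *: "ennreal (U powr p) \<le> ennreal A * (\<integral>\<^sup>+t\<in>{0<..<r}. ennreal (b t) \<partial>lborel)" .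
    define c where "c = L r powr (- p) * l r"
    have c0: "0 \<le> c" using L(3)[OF r] by (simp add: c_def)
    have "(U / L r) powr p * l r = c * U powr p"
      using U0 L(4)[OF r] by (simp add: c_def powr_divide powr_minus field_simps)
    then have "ennreal ((U / L r) powr p * l r) = ennreal c * ennreal (U powr p)"
      using c0 by (simp add: ennreal_mult)
    also have "\<dots> \<le> ennreal c * (ennreal A * (\<integral>\<^sup>+t\<in>{0<..<r}. ennreal (b t) \<partial>lborel))"
      by (rule mult_left_mono[OF *]) simp
    also have "\<dots> = ennreal (c * A) * (\<integral>\<^sup>+t\<in>{0<..<r}. ennreal (b t) \<partial>lborel)"
      using c0 by (simp add: A_def ennreal_mult mult.assoc)
    also have "c * A = a r"
    proof -
      have e: "1 / q * (p - 1) + - p = - 1 - 1 / q"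
        using p by (simp add: q field_simps)
      have "A = q powr (p - 1) * L r powr (1 / q * (p - 1))"
        using q1 L(4)[OF r] by (simp add: A_def powr_mult powr_powr)
      then have "c * A = q powr (p - 1) * (L r powr (1 / q * (p - 1)) * L r powr (- p)) * l r"
        by (simp add: c_def)
      also have "\<dots> = a r"
        unfolding powr_add[symmetric] e by (simp add: a_def)
      finally show ?thesis .
    qed
    also have "ennreal (a r) * (\<integral>\<^sup>+t\<in>{0<..<r}. ennreal (b t) \<partial>lborel)
        = (\<integral>\<^sup>+t. ennreal (a r) * (ennreal (b t) * indicator {0<..<r} t) \<partial>lborel)"
      by (rule nn_integral_cmult[symmetric], intro meas continuous_on_subset[OF cont_b]) (use r in auto)
    also have "\<dots> = (\<integral>\<^sup>+t\<in>{0<..<r}. ennreal (a r * b t) \<partial>lborel)"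
      using L(3)[OF r] by (intro nn_integral_cong) (simp add: a_def b_def ennreal_mult' mult.assoc)
    finally show ?thesis by (simp add: U_def)
  qed

  \<comment> \<open>\<open>K\<close> lives on the open triangle 0 < t < r < 1. Exchanging the
    integrals turns the inner one into the tail integral of \<open>a\<close> over (t, 1).\<close>
  define K where "K r t = ennreal (a r * b t) * indicator {0<..<r} t * indicator {0<..<1} r" for r t
  have "continuous_on ({0<..<1} \<times> {0<..<1}) (\<lambda>(r, t). a r * b t)"
    unfolding case_prod_unfold
    by (intro continuous_intros continuous_on_compose2[OF cont_a] continuous_on_compose2[OF cont_b]) auto
  then have "continuous_on {x. 0 < snd x \<and> snd x < fst x \<and> fst x < 1} (\<lambda>(r, t). a r * b t)"
    by (rule continuous_on_subset) auto
  moreover have "{x :: real \<times> real. 0 < snd x \<and> snd x < fst x \<and> fst x < 1} \<in> sets borel"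
    by (intro borel_open open_Collect_conj open_Collect_less continuous_intros)
  ultimately have "(\<lambda>x. ennreal (indicator {x. 0 < snd x \<and> snd x < fst x \<and> fst x < 1} x *\<^sub>R (case x of (r, t) \<Rightarrow> a r * b t)))
      \<in> borel_measurable borel"
    by (intro measurable_compose[OF _ measurable_ennreal] borel_measurable_continuous_on_indicator)
  also have "(\<lambda>x. ennreal (indicator {x. 0 < snd x \<and> snd x < fst x \<and> fst x < 1} x *\<^sub>R (case x of (r, t) \<Rightarrow> a r * b t)))
      = case_prod K"
    by (auto simp: fun_eq_iff indicator_def K_def)
  finally have Km: "case_prod K \<in> borel_measurable (lborel \<Otimes>\<^sub>M lborel)"
    by (simp add: lborel_prod)

  have "(\<integral>\<^sup>+r\<in>{0<..<1}. ennreal (((LINT t:{0..r}|lborel. u t) / L r) powr p * l r) \<partial>lborel)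
      \<le> (\<integral>\<^sup>+r. \<integral>\<^sup>+t. K r t \<partial>lborel \<partial>lborel)"
  proof (rule nn_integral_mono)
    fix r :: real
    show "ennreal (((LINT t:{0..r}|lborel. u t) / L r) powr p * l r) * indicator {0<..<1} r
      \<le> (\<integral>\<^sup>+t. K r t \<partial>lborel)"
      using U[of r] by (cases "0 < r \<and> r < 1") (auto simp: K_def)
  qed
  also have "\<dots> = (\<integral>\<^sup>+t. \<integral>\<^sup>+r. K r t \<partial>lborel \<partial>lborel)"
    by (rule lborel_pair.Fubini'[OF Km, symmetric])
  also have "\<dots> = (\<integral>\<^sup>+t. ennreal (q powr p) * (ennreal (u t powr p * l t powr (1 - p)) * indicator {0<..<1} t) \<partial>lborel)"
  proof (rule nn_integral_cong)
    fix t :: real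
    show "(\<integral>\<^sup>+r. K r t \<partial>lborel) = ennreal (q powr p) * (ennreal (u t powr p * l t powr (1 - p)) * indicator {0<..<1} t)"
    proof (cases "0 < t \<and> t < 1")
      case True
      have am: "(\<lambda>r. ennreal (a r) * indicator {t<..<1} r) \<in> borel_measurable lborel"
        by (intro meas continuous_on_subset[OF cont_a]) (use True in auto)
      have "(\<integral>\<^sup>+r. K r t \<partial>lborel) = (\<integral>\<^sup>+r. ennreal (b t) * (ennreal (a r) * indicator {t<..<1} r) \<partial>lborel)"
        using True by (intro nn_integral_cong)
          (auto simp: K_def indicator_def a_def b_def L(3) ennreal_mult' mult.commute less_imp_le)
      also have "\<dots> = ennreal (b t) * ennreal (q powr p * L t powr (- 1 / q))"
        using a_int[of t] True by (subst nn_integral_cmult[OF am]) simp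
      also have "\<dots> = ennreal (b t * (q powr p * L t powr (- 1 / q)))"
        by (simp add: b_def ennreal_mult)
      also have "b t * (q powr p * L t powr (- 1 / q)) = q powr p * (u t powr p * l t powr (1 - p))"
        using True L(4)[of t] by (simp add: b_def powr_minus field_simps)
      finally show ?thesis using True by (simp add: ennreal_mult)
    next
      case False
      then have "K r t = 0" for r by (auto simp: K_def indicator_def)
      then show ?thesis using False by (auto simp: indicator_def)
    qed
  qed
  also have "\<dots> = ennreal (q powr p) * (\<integral>\<^sup>+t\<in>{0<..<1}. ennreal (u t powr p * l t powr (1 - p)) \<partial>lborel)"
  proof (rule nn_integral_cmult, rule meas)
    show "continuous_on {0<..<1} (\<lambda>t. u t powr p * l t powr (1 - p))"
    proof (intro continuous_on_mult)
      show "continuous_on {0<..<1} (\<lambda>t. u t powr p)"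
        using p by (intro continuous_on_powr' continuous_intros continuous_on_subset[OF u(1)]) (auto simp: u)
      show "continuous_on {0<..<1} (\<lambda>t. l t powr (1 - p))"
        by (intro continuous_at_imp_continuous_on ballI contlpow) auto
    qed
  qed simp
  finally show ?thesis .
qed

section \<open>Hyperbolic length along a radius\<close>

lemma hyp_length_has_real_derivative:
  assumes "\<bar>r\<bar> < 1"
  shows "(hyp_length has_real_derivative 2 / (1 - r\<^sup>2)) (at r)"
proof -
  have "1 - r\<^sup>2 = (1 - r) * (1 + r)" by (simp add: power2_eq_square algebra_simps)
  then show ?thesis
    unfolding hyp_length_def using assms
    by (auto intro!: derivative_eq_intros simp: divide_simps)
qed

lemma hyp_length_pos: "0 < r \<Longrightarrow> r < 1 \<Longrightarrow> 0 < hyp_length r"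
  unfolding hyp_length_def by (intro ln_gt_zero) (simp add: field_simps)

lemma hyp_length_image: "hyp_length ` {0<..<1} = {0<..}"
proof
  show "hyp_length ` {0<..<1} \<subseteq> {0<..}" using hyp_length_pos by auto
  show "{0<..} \<subseteq> hyp_length ` {0<..<1}"
  proof
    fix s :: real assume s: "s \<in> {0<..}"
    \<comment> \<open>This is tanh (s / 2), the Euclidean radius at hyperbolic distance
      \<open>s\<close> from 0.\<close>
    let ?r = "(exp s - 1) / (exp s + 1)"
    have "(1 + (x - 1) / (x + 1)) / (1 - (x - 1) / (x + 1)) = x \<and> (x - 1) / (x + 1) \<in> {0<..<1}"
      if "1 < x" for x :: real
      using that by (auto simp: divide_simps)
    from this[of "exp s"] have "(1 + ?r) / (1 - ?r) = exp s" and "?r \<in> {0<..<1}"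
      using s by auto
    then show "s \<in> hyp_length ` {0<..<1}"
      by (intro image_eqI[of _ _ ?r]) (auto simp: hyp_length_def)
  qed
qed

lemma inj_on_hyp_length: "inj_on hyp_length {0<..<1}"
  by (rule inj_onI) (auto simp: hyp_length_def frac_eq_eq algebra_simps)

text \<open>Identifies the radius with the positive real axis of the strip; the derivative there is
  the reciprocal of that of \<open>hyp_length\<close>.\<close>

lemma strip_to_disc_hyp_length:
  assumes "0 < t" "t < 1"
  shows "strip_to_disc (of_real (hyp_length t)) = of_real t"
    and "2 * exp (of_real (hyp_length t)) / (exp (of_real (hyp_length t)) + 1)\<^sup>2
      = (of_real ((1 - t\<^sup>2) / 2) :: complex)"
proof -
  have e: "exp (of_real (hyp_length t)) = (of_real ((1 + t) / (1 - t)) :: complex)"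
    using assms by (simp add: hyp_length_def exp_of_real)
  have "((1 + t) / (1 - t) - 1) / ((1 + t) / (1 - t) + 1) = t"
    using assms by (simp add: divide_simps)
  then have "(of_real (((1 + t) / (1 - t) - 1) / ((1 + t) / (1 - t) + 1)) :: complex) = of_real t"
    by (rule arg_cong)
  then show "strip_to_disc (of_real (hyp_length t)) = of_real t"
    unfolding strip_to_disc_def e by simp
  have "2 * ((1 + t) / (1 - t)) / ((1 + t) / (1 - t) + 1)\<^sup>2 = (1 - t\<^sup>2) / 2"
    using assms by (simp add: divide_simps power2_eq_square) (simp add: algebra_simps)
  then have "(of_real (2 * ((1 + t) / (1 - t)) / ((1 + t) / (1 - t) + 1)\<^sup>2) :: complex) = of_real ((1 - t\<^sup>2) / 2)"
    by (rule arg_cong)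
  then show "2 * exp (of_real (hyp_length t)) / (exp (of_real (hyp_length t)) + 1)\<^sup>2
      = (of_real ((1 - t\<^sup>2) / 2) :: complex)"
    unfolding e by simp
qed

text \<open>The substitution s = \<open>hyp_length t\<close> turns |F|^p ds into |f'|^p times
  \<open>2 / (1 - t\<^sup>2)\<close> to the power 1 - p, exactly the right-hand integrand in Hardy's
  inequality. The radius is the half-line s > 0, bounded by the whole diameter.\<close>

lemma nn_integral_radius_le:
  fixes p \<theta> :: real and f :: "complex \<Rightarrow> complex"
  assumes p: "1 < p" and f: "f \<in> Lambda_space p"
  shows "(\<integral>\<^sup>+t\<in>{0<..<1}. ennreal (cmod (deriv f (of_real t * cis \<theta>)) powr p * (2 / (1 - t\<^sup>2)) powr (1 - p)) \<partial>lborel)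
    \<le> ennreal (2 powr p / pi * (LINT z:ball 0 1|lborel. Lambda_integrand p f z))"
proof -
  define F where "F = strip_deriv f \<theta>"
  define k where "k s = cmod (F (of_real s)) powr p" for s :: real
  have k_le: "(\<integral>\<^sup>+s. ennreal (k s) \<partial>lborel)
      \<le> ennreal (2 powr p / pi * (LINT z:ball 0 1|lborel. Lambda_integrand p f z))"
    using nn_integral_diameter_le[OF p f, of \<theta>] by (simp add: k_def F_def)
  have k_cont: "continuous_on UNIV k"
    unfolding k_def F_def
    by (intro continuous_on_compose2[OF continuous_on_strip_deriv_powr[of p f]] continuous_intros)
      (use p f in \<open>auto simp: hyp_strip_def Lambda_space_def\<close>)
  have k_int: "integrable lborel k"
  proof (rule integrableI_bounded)
    show "k \<in> borel_measurable lborel"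
      using borel_measurable_continuous_onI[OF k_cont] by simp
    have "(\<integral>\<^sup>+s. ennreal (norm (k s)) \<partial>lborel) = (\<integral>\<^sup>+s. ennreal (k s) \<partial>lborel)"
      by (simp add: k_def)
    then show "(\<integral>\<^sup>+s. ennreal (norm (k s)) \<partial>lborel) < \<infinity>"
      using k_le by (simp add: le_less_trans[OF _ ennreal_less_top])
  qed
  have k_pos: "set_integrable lborel {0<..} k"
    unfolding set_integrable_def by (rule integrable_mult_indicator[OF _ k_int]) simp
  have kl: "\<bar>2 / (1 - t\<^sup>2)\<bar> * k (hyp_length t)
      = cmod (deriv f (of_real t * cis \<theta>)) powr p * (2 / (1 - t\<^sup>2)) powr (1 - p)" if t: "0 < t" "t < 1" for t
  proof -
    have t2: "0 < 1 - t\<^sup>2" using t by (simp add: power_less_one_iff)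
    have "F (of_real (hyp_length t)) = deriv f (of_real t * cis \<theta>) * of_real ((1 - t\<^sup>2) / 2)"
      unfolding F_def strip_deriv_def strip_to_disc_hyp_length[OF t] by (simp add: mult.commute)
    then have Feq: "cmod (F (of_real (hyp_length t))) = cmod (deriv f (of_real t * cis \<theta>)) * ((1 - t\<^sup>2) / 2)"
      using t2 by (simp only: norm_mult norm_of_real) simp
    show ?thesis
      unfolding k_def Feq using t2 by (simp add: powr_mult powr_divide powr_diff)
  qed
  define h where "h = (\<lambda>t. \<bar>2 / (1 - t\<^sup>2)\<bar> * k (hyp_length t))"
  have h0: "0 \<le> h t" for t by (simp add: h_def k_def)
  have "k absolutely_integrable_on hyp_length ` {0<..<1}"
    unfolding hyp_length_image
    using absolutely_integrable_on_iff_set_integrable[OF _ continuous_on_subset[OF k_cont]] k_pos by auto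
  moreover have "h absolutely_integrable_on {0<..<1} \<and> integral {0<..<1} h = integral {0<..} k \<longleftrightarrow>
      k absolutely_integrable_on hyp_length ` {0<..<1} \<and> integral (hyp_length ` {0<..<1}) k = integral {0<..} k"
    unfolding h_def
  proof (rule has_absolute_integral_change_of_variables_1'[where f = k and g = hyp_length
        and g' = "\<lambda>t. 2 / (1 - t\<^sup>2)", OF _ _ inj_on_hyp_length])
    show "(hyp_length has_real_derivative 2 / (1 - t\<^sup>2)) (at t within {0<..<1})" if "t \<in> {0<..<1}" for t
      by (rule has_field_derivative_at_within, rule hyp_length_has_real_derivative) (use that in auto)
  qed simp
  ultimately have h_abs: "h absolutely_integrable_on {0<..<1}"
    and h_eq: "integral {0<..<1} h = integral {0<..} k"
    unfolding hyp_length_image by blast+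
  have h_cont: "continuous_on {0<..<1} h"
  proof -
    have "continuous_on {0<..<1} hyp_length"
      by (rule DERIV_continuous_on, rule has_field_derivative_at_within,
          rule hyp_length_has_real_derivative) auto
    moreover have "1 - t\<^sup>2 \<noteq> 0" if "t \<in> {0<..<1}" for t :: real
      using that by (simp add: power2_eq_1_iff)
    ultimately show ?thesis
      unfolding h_def by (intro continuous_intros continuous_on_compose2[OF k_cont]) auto
  qed
  have h_int: "set_integrable lborel {0<..<1} h"
    using absolutely_integrable_on_iff_set_integrable[OF _ h_cont] h_abs by simp
  have "(\<integral>\<^sup>+t\<in>{0<..<1}. ennreal (cmod (deriv f (of_real t * cis \<theta>)) powr p * (2 / (1 - t\<^sup>2)) powr (1 - p)) \<partial>lborel)
      = (\<integral>\<^sup>+t\<in>{0<..<1}. ennreal (h t) \<partial>lborel)"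
  proof (rule nn_integral_cong)
    fix t :: real
    show "ennreal (cmod (deriv f (of_real t * cis \<theta>)) powr p * (2 / (1 - t\<^sup>2)) powr (1 - p)) * indicator {0<..<1} t
        = ennreal (h t) * indicator {0<..<1} t"
      unfolding h_def by (cases "0 < t \<and> t < 1") (simp only: kl, simp)
  qed
  also have "\<dots> = ennreal (LINT t:{0<..<1}|lborel. h t)"
    by (rule set_nn_integral_eq_set_integral[OF h_int h0])
  also have "(LINT t:{0<..<1}|lborel. h t) = (LINT s:{0<..}|lborel. k s)"
    using h_eq set_borel_integral_eq_integral(2)[OF h_int] set_borel_integral_eq_integral(2)[OF k_pos] by simp
  also have "ennreal \<dots> = (\<integral>\<^sup>+s\<in>{0<..}. ennreal (k s) \<partial>lborel)"
    by (rule set_nn_integral_eq_set_integral[OF k_pos, symmetric]) (simp add: k_def)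
  also have "\<dots> \<le> (\<integral>\<^sup>+s. ennreal (k s) \<partial>lborel)"
    by (intro nn_integral_mono) (auto simp: indicator_def)
  also note k_le
  finally show ?thesis .
qed

lemma tendsto_hyp_length_0: "(hyp_length \<longlongrightarrow> 0) (at_right 0)"
proof -
  have "isCont hyp_length 0"
    by (rule DERIV_isCont, rule hyp_length_has_real_derivative) simp
  moreover have "hyp_length 0 = 0" by (simp add: hyp_length_def)
  ultimately show ?thesis by (simp add: isCont_def filterlim_at_split)
qed

lemma filterlim_hyp_length_at_top: "filterlim hyp_length at_top (at_left 1)"
  unfolding hyp_length_def by real_asymp

section \<open>The norm bound and its integrability consequence\<close>

theorem theorem7p1:
  fixes p q \<theta> :: real and f :: "complex \<Rightarrow> complex"
  assumes "1 < p" and "1 / p + 1 / q = 1"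
    and "f \<in> Lambda_space p"
  shows "set_integrable lborel {0<..<1}
           (\<lambda>r. (radial_length f r \<theta> / hyp_length r) powr p * (2 / (1 - r\<^sup>2)))
       \<and> (LINT r:{0<..<1}|lborel.
            (radial_length f r \<theta> / hyp_length r) powr p * (2 / (1 - r\<^sup>2))) powr (1 / p)
           \<le> 2 * q / pi powr (1 / p) * Lambda_norm p f
       \<and> set_integrable lborel {0<..<1}
           (\<lambda>r. radial_length f r \<theta> powr p / ((1 - r\<^sup>2) * ln ((1 + r) / (1 - r)) powr p))"
proof -
  define u where "u t = cmod (deriv f (of_real t * cis \<theta>))" for t
  define g where "g r = (radial_length f r \<theta> / hyp_length r) powr p * (2 / (1 - r\<^sup>2))" for r
  define N where "N = (LINT z:ball 0 1|lborel. Lambda_integrand p f z)"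
  \<comment> \<open>The p-th power of the claimed bound, \<open>N\<close> being the p-th power of
    the norm.\<close>
  define C where "C = q powr p * (2 powr p / pi * N)"
  have q0: "0 < q"
  proof -
    have "1 / p < 1" using assms(1) by simp
    then have "1 / q > 0" using assms(2) by linarith
    then show ?thesis by simp
  qed
  have N0: "0 \<le> N"
    unfolding N_def set_lebesgue_integral_def
    by (rule Bochner_Integration.integral_nonneg) (simp add: Lambda_integrand_def)
  have C0: "0 \<le> C" using N0 by (simp add: C_def)
  have len: "radial_length f r \<theta> = (LINT t:{0..r}|lborel. u t)" for r
    by (simp add: radial_length_def u_def)
  have sq: "0 < 1 - r\<^sup>2" if "0 < r" "r < 1" for r :: real
    using that by (simp add: power_less_one_iff)
  have u_cont: "continuous_on {0..<1} u"
  proof -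
    have "deriv f holomorphic_on ball 0 1"
      using assms(3) by (auto simp: Lambda_space_def intro: holomorphic_deriv)
    note cont = holomorphic_on_imp_continuous_on[OF this]
    have "continuous_on {0..<1} (\<lambda>t. deriv f (of_real t * cis \<theta>))"
      by (rule continuous_on_compose2[OF cont]) (auto simp: norm_mult intro!: continuous_intros)
    then show ?thesis
      unfolding u_def by (rule continuous_on_norm)
  qed
  have u_int: "set_integrable lborel {0..r} u" if "r < 1" for r
    unfolding set_integrable_def
    by (intro borel_integrable_compact continuous_on_subset[OF u_cont]) (use that in auto)
  \<comment> \<open>Monotonicity in the radius makes the radial length Borel measurable, which the
    integrability of \<open>g\<close> requires.\<close>
  have "mono_on {0<..<1} (\<lambda>r. radial_length f r \<theta>)"
  proof (rule mono_onI)
    fix r s :: real assume "r \<in> {0<..<1}" "s \<in> {0<..<1}" "r \<le> s"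
    then show "radial_length f r \<theta> \<le> radial_length f s \<theta>"
      unfolding len set_lebesgue_integral_def using u_int[of r] u_int[of s]
      by (intro integral_mono) (auto simp: set_integrable_def indicator_def u_def)
  qed
  then have len_meas: "(\<lambda>r. radial_length f r \<theta>) \<in> borel_measurable (restrict_space borel {0<..<1})"
    by (rule borel_measurable_mono_on_fnc)
  have "continuous_on {0<..<1} hyp_length"
    by (rule DERIV_continuous_on, rule has_field_derivative_at_within,
        rule hyp_length_has_real_derivative) auto
  then have "hyp_length \<in> borel_measurable (restrict_space borel {0<..<1})"
    by (rule borel_measurable_continuous_on_restrict)
  moreover have "(\<lambda>r. r) \<in> borel_measurable (restrict_space borel {0<..<1 :: real})"
    by (rule measurable_restrict_space1) simp
  ultimately have "g \<in> borel_measurable (restrict_space borel {0<..<1})"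
    unfolding g_def using len_meas by measurable
  then have g_meas: "(\<lambda>r. indicator {0<..<1} r *\<^sub>R g r) \<in> borel_measurable lborel"
    by (subst (asm) borel_measurable_restrict_space_iff) auto
  have g0: "0 \<le> g r" if "0 < r" "r < 1" for r
    using sq[OF that] by (simp add: g_def)
  have "(\<integral>\<^sup>+r\<in>{0<..<1}. ennreal (g r) \<partial>lborel)
      \<le> ennreal (q powr p) * (\<integral>\<^sup>+t\<in>{0<..<1}. ennreal (u t powr p * (2 / (1 - t\<^sup>2)) powr (1 - p)) \<partial>lborel)"
    unfolding g_def len
  \<comment> \<open>Here \<open>L\<close> is \<open>hyp_length\<close> and \<open>l\<close> its
    derivative, so \<open>l r dr\<close> is the measure of hyperbolic length.\<close>
  proof (rule Hardy_inequality_substituted[OF assms(1,2) u_cont])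
    show "isCont (\<lambda>r. 2 / (1 - r\<^sup>2)) r" if "0 < r" "r < 1" for r :: real
      using sq[OF that] by (intro continuous_intros) auto
  qed (use sq in \<open>auto simp: u_def hyp_length_has_real_derivative hyp_length_pos
      tendsto_hyp_length_0 filterlim_hyp_length_at_top\<close>)
  also have "\<dots> \<le> ennreal (q powr p) * ennreal (2 powr p / pi * N)"
    unfolding u_def N_def by (intro mult_left_mono nn_integral_radius_le assms) simp
  also have "\<dots> = ennreal C"
    unfolding C_def by (rule ennreal_mult[symmetric]) (use N0 in auto)
  finally have g_le: "(\<integral>\<^sup>+r\<in>{0<..<1}. ennreal (g r) \<partial>lborel) \<le> ennreal C" .
  have g_int: "set_integrable lborel {0<..<1} g"
    unfolding set_integrable_def
  proof (rule integrableI_bounded[OF g_meas])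
    have "(\<integral>\<^sup>+r. ennreal (norm (indicator {0<..<1} r *\<^sub>R g r)) \<partial>lborel)
        = (\<integral>\<^sup>+r\<in>{0<..<1}. ennreal (g r) \<partial>lborel)"
      by (intro nn_integral_cong) (auto simp: indicator_def g0)
    then show "(\<integral>\<^sup>+r. ennreal (norm (indicator {0<..<1} r *\<^sub>R g r)) \<partial>lborel) < \<infinity>"
      using g_le by (simp add: le_less_trans[OF _ ennreal_less_top])
  qed
  have "(LINT r:{0<..<1}|lborel. g r) \<le> C"
    using g_le set_nn_integral_eq_set_integral[OF g_int] g0 C0 by simp
  moreover have "0 \<le> (LINT r:{0<..<1}|lborel. g r)"
    unfolding set_lebesgue_integral_def
    by (rule Bochner_Integration.integral_nonneg) (auto simp: indicator_def g0)
  ultimately have "(LINT r:{0<..<1}|lborel. g r) powr (1 / p) \<le> C powr (1 / p)"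
    using assms(1) by (intro powr_mono2) auto
  also have "\<dots> = 2 * q / pi powr (1 / p) * Lambda_norm p f"
    using q0 N0 assms(1)
    by (simp add: C_def Lambda_norm_def N_def[symmetric] powr_mult powr_divide powr_powr)
  finally have bound: "(LINT r:{0<..<1}|lborel. g r) powr (1 / p) \<le> 2 * q / pi powr (1 / p) * Lambda_norm p f" .
  \<comment> \<open>The last integrand is half of \<open>g\<close>, whose density carries the
    numerator 2.\<close>
  have "set_integrable lborel {0<..<1} (\<lambda>r. (1 / 2) * g r)"
    using g_int by (rule set_integrable_mult_right)
  moreover have "(1 / 2) * g r = radial_length f r \<theta> powr p / ((1 - r\<^sup>2) * ln ((1 + r) / (1 - r)) powr p)"
    if "r \<in> {0<..<1}" for r
  proof -
    have "0 \<le> radial_length f r \<theta>"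
      unfolding len set_lebesgue_integral_def
      by (rule Bochner_Integration.integral_nonneg) (simp add: u_def)
    moreover have "0 < hyp_length r" using that by (simp add: hyp_length_pos)
    ultimately show ?thesis
      by (simp add: g_def powr_divide hyp_length_def mult.commute)
  qed
  ultimately have "set_integrable lborel {0<..<1}
      (\<lambda>r. radial_length f r \<theta> powr p / ((1 - r\<^sup>2) * ln ((1 + r) / (1 - r)) powr p))"
    by (subst (asm) set_integrable_cong[OF refl refl]) auto
  with g_int bound show ?thesis unfolding g_def by blast
qed

end
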